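(* Let $u$ be a (non-negative) minimizer of $$\min_{v\in\mathcal{K}_g(\Omega)}\int_\Omega\mathcal{F}(x,v,\nabla v)\,dx .$$ Let $$\mu_\Phi=\mathrm{div}(\Phi(x,\nabla u))-\lambda_0(x)u^{q}(x)\chi_{\{u>0\}},$$ i.e. $\int_\Omega v\,d\mu_\Phi=-\int_\Omega\left(\Phi(x,\nabla u)\cdot\nabla v+\lambda_0(x)u^q(x)\chi_{\{u>0\}}v\right)dx$ for $v\in C_0^\infty(\Omega)$. Then $\mu_\Phi$ defines a non-negative Radon measure supported on $\partial\{u>0\}\cap\Omega$.
   Context: $\Omega\subset\mathbb{R}^N$ is a regular bounded domain, $1<p<\infty$, $0\le q<p-1$, $0\le g\in C^0(\partial\Omega)$, $\mathcal{K}_g(\Omega)=\{v\in W^{1,p}(\Omega): v=g\text{ on }\partial\Omega\}$, and $\mathcal{F}(x,u,\nabla u)=\mathcal{G}(x,\nabla u)+\mathfrak{h}(x,u)$, where: - $x\mapsto\mathcal{G}(x,\xi)$ is continuous for all $\xi\in\mathbb{R}^N$; - there is $\zeta>0$ with $\zeta|\xi|^p\le\mathcal{G}(x,\xi)\le\zeta^{-1}|\xi|^p$; - $\xi\mapsto\mathcal{G}(x,\xi)$ is differentiable and strictly convex, $\Phi(x,\xi)=\nabla_\xi\mathcal{G}(x,\xi)$, and $\frac{d}{du}\mathfrak{h}(x,u)=(q+1)\lambda(x)u_+^q$, with $\lambda$ continuous on $\overline\Omega$, non-negative and bounded. Set $\lambda_0(x)=(q+1)\lambda(x)$. Under these conditions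 minimizers are non-negative and are weak solutions of $-\mathrm{div}(\Phi(x,\nabla u))+\lambda_0u^q=0$ in $\{u>0\}\cap\Omega$. The vector field $\Phi=\Phi(x,\xi)$ is moreover assumed to satisfy, for some positive constants $c_1,c_2,c_3,c_4,\kappa_1$ (these conditions are stated for fields $\Phi(x,z,\xi)$, here independent of $z$): (H1) $\Phi$ is continuous; (H2) $\langle\Phi(x,\xi_1)-\Phi(x,\xi_2),\xi_1-\xi_2\rangle\ge0$; (H3) $\langle\Phi(x,\xi),\xi\rangle\ge c_1|\xi|^p-c_2|z|^p$ for all $z\in\mathbb{R}$; (H4) $|\Phi(x,\xi)|\le c_3|\xi|^{p-1}+c_4|z|^{p-1}$ for all $z\in\mathbb{R}$; (A1) $\Phi$ is $C^1$ for $\xi\neq0$; (A2) (for $p\ge2$) $\sum_{i,j}|\partial_{\xi_j}\Phi_i(x,\xi)|\le\kappa_1|\xi|^{p-2}$ and $\sum_{i,j}|\partial_{x_j}\Phi_i(x,\xi)|\le\kappa_1|\xi|^{p-1}$ for a.e. $x$ and all $\xi\neq0$. *)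

theory Defs
  imports "HOL-Analysis.Analysis"
begin

(* Boundary locally the graph of a Lipschitz function over a hyperplane orthogonal to e,
   with the set lying on one side of the graph. *)
definition lipschitz_boundary :: "'a::euclidean_space set \<Rightarrow> bool" where
  "lipschitz_boundary \<Omega> \<longleftrightarrow>
     (\<forall>x0\<in>frontier \<Omega>. \<exists>e \<psi> L r. norm e = 1 \<and> r > 0 \<and> L-lipschitz_on {y. y \<bullet> e = 0} \<psi> \<and>
        \<Omega> \<inter> ball x0 r = {x\<in>ball x0 r. \<psi> (x - (x \<bullet> e) *\<^sub>R e) < x \<bullet> e})"

(* "Regular" is read as "with Lipschitz boundary", which covers all smoother boundaries. *)
definition regular_bounded_domain :: "'a::euclidean_space set \<Rightarrow> bool" where
  "regular_bounded_domain \<Omega> \<longleftrightarrow>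
     open \<Omega> \<and> connected \<Omega> \<and> \<Omega> \<noteq> {} \<and> bounded \<Omega> \<and> lipschitz_boundary \<Omega>"

definition strictly_convex_on :: "'a::real_vector set \<Rightarrow> ('a \<Rightarrow> real) \<Rightarrow> bool" where
  "strictly_convex_on S f \<longleftrightarrow> convex S \<and>
     (\<forall>x\<in>S. \<forall>y\<in>S. \<forall>t. x \<noteq> y \<and> 0 < t \<and> t < 1 \<longrightarrow>
        f ((1 - t) *\<^sub>R x + t *\<^sub>R y) < (1 - t) * f x + t * f y)"

(* Intended for open S. *)
primrec Ck_on :: "nat \<Rightarrow> ('a::euclidean_space \<Rightarrow> 'b::real_normed_vector) \<Rightarrow> 'a set \<Rightarrow> bool" where
  "Ck_on 0 f S \<longleftrightarrow> continuous_on S f"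
| "Ck_on (Suc k) f S \<longleftrightarrow> f differentiable_on S \<and>
     (\<forall>b\<in>Basis. Ck_on k (\<lambda>x. frechet_derivative f (at x) b) S)"

definition grad :: "('a::euclidean_space \<Rightarrow> real) \<Rightarrow> 'a \<Rightarrow> 'a" where
  "grad f x = (\<Sum>b\<in>Basis. frechet_derivative f (at x) b *\<^sub>R b)"

(* Smooth functions with compact support in the open set \<Omega>, extended by 0. *)
definition test_functions :: "'a::euclidean_space set \<Rightarrow> ('a \<Rightarrow> real) set" where
  "test_functions \<Omega> = {\<phi>. (\<forall>k. Ck_on k \<phi> UNIV) \<and>
     compact (closure {x. \<phi> x \<noteq> 0}) \<and> closure {x. \<phi> x \<noteq> 0} \<subseteq> \<Omega>}"

definition locally_integrable_on :: "'a::euclidean_space set \<Rightarrow> ('a \<Rightarrow> 'b::euclidean_space) \<Rightarrow> bool" where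
  "locally_integrable_on \<Omega> f \<longleftrightarrow> (\<forall>K. compact K \<and> K \<subseteq> \<Omega> \<longrightarrow> integrable (lebesgue_on K) f)"

definition has_weak_gradient :: "'a::euclidean_space set \<Rightarrow> ('a \<Rightarrow> real) \<Rightarrow> ('a \<Rightarrow> 'a) \<Rightarrow> bool" where
  "has_weak_gradient \<Omega> u w \<longleftrightarrow> locally_integrable_on \<Omega> u \<and> locally_integrable_on \<Omega> w \<and>
     (\<forall>\<phi>\<in>test_functions \<Omega>.
        (LINT x|lebesgue_on \<Omega>. u x *\<^sub>R grad \<phi> x) = - (LINT x|lebesgue_on \<Omega>. \<phi> x *\<^sub>R w x))"

(* Weak gradients are unique up to null sets; an arbitrary representative is chosen. *)
definition weak_grad :: "'a::euclidean_space set \<Rightarrow> ('a \<Rightarrow> real) \<Rightarrow> 'a \<Rightarrow> 'a" where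
  "weak_grad \<Omega> u = (SOME w. has_weak_gradient \<Omega> u w)"

definition Lp :: "'a::euclidean_space set \<Rightarrow> real \<Rightarrow> ('a \<Rightarrow> 'b::euclidean_space) set" where
  "Lp \<Omega> p = {f \<in> borel_measurable (lebesgue_on \<Omega>).
     integrable (lebesgue_on \<Omega>) (\<lambda>x. norm (f x) powr p)}"

definition W1p :: "'a::euclidean_space set \<Rightarrow> real \<Rightarrow> ('a \<Rightarrow> real) set" where
  "W1p \<Omega> p = {u \<in> Lp \<Omega> p. \<exists>w \<in> Lp \<Omega> p. has_weak_gradient \<Omega> u w}"

(* Closure of the test functions in the Sobolev norm. *)
definition W1p_0 :: "'a::euclidean_space set \<Rightarrow> real \<Rightarrow> ('a \<Rightarrow> real) set" where
  "W1p_0 \<Omega> p = {u \<in> W1p \<Omega> p. \<exists>\<phi> :: nat \<Rightarrow> 'a \<Rightarrow> real. (\<forall>n. \<phi> n \<in> test_functions \<Omega>) \<and>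
     (\<lambda>n. LINT x|lebesgue_on \<Omega>. \<bar>u x - \<phi> n x\<bar> powr p) \<longlonglongrightarrow> 0 \<and>
     (\<lambda>n. LINT x|lebesgue_on \<Omega>. norm (weak_grad \<Omega> u x - grad (\<phi> n) x) powr p) \<longlonglongrightarrow> 0}"

(* The boundary condition v = g holds in the Sobolev sense: v differs by an element of W1p_0
   from some (equivalently, any) Sobolev function that is continuous up to the boundary and
   equal to g there. If g has no such extension, the class is empty. *)
definition K_class :: "'a::euclidean_space set \<Rightarrow> real \<Rightarrow> ('a \<Rightarrow> real) \<Rightarrow> ('a \<Rightarrow> real) set" where
  "K_class \<Omega> p g = {v \<in> W1p \<Omega> p. \<exists>w \<in> W1p \<Omega> p. continuous_on (closure \<Omega>) w \<and>
     (\<forall>x\<in>frontier \<Omega>. w x = g x) \<and> (\<lambda>x. v x - w x) \<in> W1p_0 \<Omega> p}"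

(* Integrability is explicit because the integral of a non-integrable function is 0;
   competitors whose energy is not integrable are disregarded. *)
definition is_minimizer ::
  "'a::euclidean_space set \<Rightarrow> ('a \<Rightarrow> real \<Rightarrow> 'a \<Rightarrow> real) \<Rightarrow> ('a \<Rightarrow> real) set \<Rightarrow> ('a \<Rightarrow> real) \<Rightarrow> bool" where
  "is_minimizer \<Omega> F K u \<longleftrightarrow> u \<in> K \<and>
     integrable (lebesgue_on \<Omega>) (\<lambda>x. F x (u x) (weak_grad \<Omega> u x)) \<and>
     (\<forall>v\<in>K. integrable (lebesgue_on \<Omega>) (\<lambda>x. F x (v x) (weak_grad \<Omega> v x)) \<longrightarrow>
        (LINT x|lebesgue_on \<Omega>. F x (u x) (weak_grad \<Omega> u x))
          \<le> (LINT x|lebesgue_on \<Omega>. F x (v x) (weak_grad \<Omega> v x)))"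

definition radon_measure_on :: "'a::euclidean_space set \<Rightarrow> 'a measure \<Rightarrow> bool" where
  "radon_measure_on \<Omega> \<mu> \<longleftrightarrow> sets \<mu> = sets (restrict_space borel \<Omega>) \<and>
     (\<forall>K. compact K \<and> K \<subseteq> \<Omega> \<longrightarrow> emeasure \<mu> K < \<infinity>) \<and>
     (\<forall>A\<in>sets \<mu>. emeasure \<mu> A = (SUP K\<in>{K. compact K \<and> K \<subseteq> A}. emeasure \<mu> K))"

definition measure_support :: "'a::topological_space measure \<Rightarrow> 'a set" where
  "measure_support \<mu> = {x\<in>space \<mu>. \<forall>U. open U \<and> x \<in> U \<longrightarrow> emeasure \<mu> (U \<inter> space \<mu>) > 0}"

end

theory Submission
  imports Defs
begin

text \<open>
  Write \<open>w\<close> for the weak gradient of the minimizer \<open>u\<close> and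
  \<open>L v = - \<integral> (\<Phi>(x, w) \<bullet> grad v + (q + 1) lam u\<^sup>q \<chi> v) dx\<close>, where \<open>\<chi>\<close> is the indicator of \<open>{u > 0}\<close>.
  Comparing \<open>u\<close> with \<open>u + t v\<close> for a test function \<open>v\<close> and letting \<open>t\<close> decrease to \<open>0\<close> gives an
  inequality, not an equation: the term \<open>s \<mapsto> max s 0 powr (q + 1)\<close> hidden in \<open>h\<close> has at \<open>s = 0\<close> the
  one-sided derivative \<open>0\<close> if \<open>q > 0\<close>, but \<open>max v 0\<close> in direction \<open>v\<close> if \<open>q = 0\<close>. So with
  \<open>k = lam\<close> on \<open>{u = 0}\<close> for \<open>q = 0\<close>, and \<open>k = 0\<close> otherwise, the first variation
  (\<open>first_variation\<close>) says

    \<open>L v \<le> \<integral> k max v 0 dx\<close> for every test function \<open>v\<close>.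

  Everything follows from this single bound. For \<open>v \<le> 0\<close> it says that \<open>L\<close> is a positive functional,
  and it says that \<open>L\<close> is dominated by the finite measure \<open>k dx\<close>. By the Hahn-Banach theorem
  (\<open>hahn_banach\<close>) \<open>L\<close> extends, with the same bound, to all functions integrable for \<open>k dx\<close>. The
  extension is defined on indicator functions, and \<open>A \<mapsto> L 1\<^sub>A\<close> is countably additive because
  \<open>0 \<le> L 1\<^sub>A \<le> \<integral>\<^sub>A k dx\<close>; this is the measure, and it integrates test functions as \<open>L\<close> does
  (\<open>dominated_functional_measure\<close>). Being finite on a Euclidean space, it is a Radon measure.

  The support is located by two observations. In the interior of \<open>{u > 0}\<close> the weight \<open>k\<close> vanishes, and
  the measure lies below \<open>k dx\<close>. Outside the closure of \<open>{u > 0}\<close> the function \<open>u\<close> is \<open>0\<close> almost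
  everywhere, so \<open>w = 0\<close> almost everywhere and \<open>\<Phi>(x, w) = 0\<close> by the growth bound; hence \<open>L\<close> annihilates
  a smooth bump that is positive on a small box, and the box is a null set. Both observations use only
  the sign of \<open>u\<close> at the points of an open set, so the claim holds for every representative of the
  minimizer.

  Since a weak gradient is an arbitrary choice among almost everywhere equal functions, the comparison
  needs its uniqueness, in order to identify the chosen gradient of \<open>u + t v\<close> with \<open>w + t grad v\<close>. This
  is the fundamental lemma of the calculus of variations (\<open>fundamental_lemma_variations\<close>), proved
  with explicit smooth bumps. The other ingredient is that the gradient of a test function is also
  its weak gradient, that is, integration by parts, which comes from translation invariance of Lebesgue
  measure (\<open>integral_grad_test_zero\<close>).
\<close>

section \<open>Test functions and smooth bumps\<close>

lemma Ck_on_Suc_imp: "Ck_on (Suc k) f S \<Longrightarrow> Ck_on k f S"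
  by (induction k arbitrary: f) (auto intro: differentiable_imp_continuous_on)

lemma frechet_derivative_unique:
  "(f has_derivative f') (at x) \<Longrightarrow> frechet_derivative f (at x) = f'"
  by (rule frechet_derivative_at[symmetric])

lemma differentiable_on_UNIV_has_derivative:
  "f differentiable_on UNIV \<Longrightarrow> (f has_derivative frechet_derivative f (at x)) (at x)"
  by (auto simp: differentiable_on_def frechet_derivative_works)

lemma Ck_on_add:
  "Ck_on k f UNIV \<Longrightarrow> Ck_on k g UNIV \<Longrightarrow> Ck_on k (\<lambda>x. f x + g x) UNIV"
proof (induction k arbitrary: f g)
  case 0
  then show ?case by (auto intro: continuous_intros)
next
  case (Suc k)
  have "frechet_derivative (\<lambda>x. f x + g x) (at x)
      = (\<lambda>h. frechet_derivative f (at x) h + frechet_derivative g (at x) h)" for x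
    using Suc.prems
    by (intro frechet_derivative_unique has_derivative_add differentiable_on_UNIV_has_derivative) auto
  with Suc show ?case by (auto intro: differentiable_on_add)
qed

lemma Ck_on_mult:
  fixes f g :: "'a::euclidean_space \<Rightarrow> real"
  shows "Ck_on k f UNIV \<Longrightarrow> Ck_on k g UNIV \<Longrightarrow> Ck_on k (\<lambda>x. f x * g x) UNIV"
proof (induction k arbitrary: f g)
  case 0
  then show ?case by (auto intro: continuous_intros)
next
  case (Suc k)
  have D: "frechet_derivative (\<lambda>x. f x * g x) (at x)
      = (\<lambda>h. f x * frechet_derivative g (at x) h + frechet_derivative f (at x) h * g x)" for x
    using Suc.prems
    by (intro frechet_derivative_unique has_derivative_mult differentiable_on_UNIV_has_derivative) auto
  have "(\<lambda>x. f x * g x) differentiable_on UNIV"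
    using Suc.prems by (auto simp: differentiable_on_def intro: differentiable_mult)
  moreover have "Ck_on k f UNIV" "Ck_on k g UNIV"
    using Suc.prems by (simp_all only: Ck_on_Suc_imp)
  ultimately show ?case using Suc by (auto simp: D intro: Ck_on_add)
qed

lemma Ck_on_const: "Ck_on k (\<lambda>x. c) UNIV"
proof (induction k arbitrary: c)
  case (Suc k)
  have "frechet_derivative (\<lambda>x. c) (at x) = (\<lambda>h. 0)" for x :: 'a
    by (intro frechet_derivative_unique) auto
  then show ?case using Suc by simp
qed simp

lemma Ck_on_prod:
  fixes f :: "'i \<Rightarrow> 'a::euclidean_space \<Rightarrow> real"
  assumes "\<And>i. i \<in> I \<Longrightarrow> Ck_on k (f i) UNIV"
  shows "Ck_on k (\<lambda>x. \<Prod>i\<in>I. f i x) UNIV"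
  using assms
  by (induction I rule: infinite_finite_induct) (auto intro: Ck_on_mult Ck_on_const)

text \<open>For \<open>m = 0\<close> this is the standard smooth function that is flat at \<open>0\<close>. The powers of \<open>t\<close> in the
  denominator are carried along so that the family is closed under differentiation up to linear
  combinations, which turns smoothness into an induction.\<close>
definition flat_exp :: "nat \<Rightarrow> real \<Rightarrow> real" where
  "flat_exp m t = (if t \<le> 0 then 0 else exp (- 1 / t) / t ^ m)"

text \<open>At \<open>t = 0\<close> the derivative vanishes because \<open>exp (- 1 / h)\<close> beats every power of \<open>1 / h\<close>.\<close>
lemma flat_exp_has_derivative:
  "(flat_exp m has_real_derivative flat_exp (m + 2) t - real m * flat_exp (m + 1) t) (at t)"
proof -
  consider "t < 0" | "t > 0" | "t = 0" by linarith
  then show ?thesis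
  proof cases
    case 1
    have "((\<lambda>_. 0) has_real_derivative 0) (at t)" by simp
    then have "(flat_exp m has_real_derivative 0) (at t)"
      by (rule has_field_derivative_transform_within_open[where S="{..<0}"])
         (use 1 in \<open>auto simp: flat_exp_def\<close>)
    with 1 show ?thesis by (simp add: flat_exp_def)
  next
    case 2
    have "((\<lambda>t. t ^ m) has_real_derivative real m * t ^ m / t) (at t)"
      using DERIV_pow[of m t UNIV] 2 by (cases m) (simp_all add: add_divide_distrib)
    moreover have "((\<lambda>t. exp (- 1 / t)) has_real_derivative exp (- 1 / t) / t\<^sup>2) (at t)"
      using 2 by (auto intro!: derivative_eq_intros simp: field_simps power2_eq_square)
    ultimately have "((\<lambda>t. exp (- 1 / t) / t ^ m) has_real_derivative
        (exp (- 1 / t) / t\<^sup>2 * t ^ m - exp (- 1 / t) * (real m * t ^ m / t)) / (t ^ m * t ^ m)) (at t)"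
      using 2 by (intro DERIV_divide) auto
    also have "(exp (- 1 / t) / t\<^sup>2 * t ^ m - exp (- 1 / t) * (real m * t ^ m / t)) / (t ^ m * t ^ m)
        = flat_exp (m + 2) t - real m * flat_exp (m + 1) t"
      using 2 by (simp add: flat_exp_def field_simps power2_eq_square)
    finally show ?thesis
      by (rule has_field_derivative_transform_within_open[where S="{0<..}"])
         (use 2 in \<open>auto simp: flat_exp_def\<close>)
  next
    case 3
    have "((\<lambda>h. flat_exp m h / h) \<longlongrightarrow> 0) (at_left 0)"
      by (rule tendsto_eventually) (auto simp: eventually_at_left_field flat_exp_def intro: exI[of _ "-1"])
    moreover have "((\<lambda>h. flat_exp m h / h) \<longlongrightarrow> 0) (at_right 0)"
    proof -
      have "((\<lambda>h::real. inverse h ^ (m + 1) / exp (inverse h)) \<longlongrightarrow> 0) (at_right 0)"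
        by (rule filterlim_compose[OF tendsto_power_div_exp_0 filterlim_inverse_at_top_right])
      then show ?thesis
        by (rule Lim_transform_eventually)
           (auto simp: eventually_at_right_field flat_exp_def exp_minus field_simps intro!: exI[of _ 1])
    qed
    ultimately have "((\<lambda>h. flat_exp m h / h) \<longlongrightarrow> 0) (at 0)"
      by (simp add: filterlim_split_at)
    with 3 show ?thesis by (simp add: has_field_derivative_iff flat_exp_def)
  qed
qed

lemma Ck_on_flat_exp_affine:
  fixes e :: "'a::euclidean_space"
  shows "Ck_on k (\<lambda>x. flat_exp m (x \<bullet> e + c)) UNIV"
proof (induction k arbitrary: m)
  have D: "((\<lambda>x. flat_exp m (x \<bullet> e + c)) has_derivative
      (\<lambda>h. (h \<bullet> e) * (flat_exp (m + 2) (x \<bullet> e + c) - real m * flat_exp (m + 1) (x \<bullet> e + c)))) (at x)" for m x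
  proof -
    have "((\<lambda>x. x \<bullet> e + c) has_derivative (\<lambda>h. h \<bullet> e)) (at x)"
      by (auto intro!: derivative_eq_intros)
    from has_derivative_compose[OF this flat_exp_has_derivative[unfolded has_field_derivative_def]]
    show ?thesis by (simp add: mult.commute)
  qed
  case 0
  show ?case using has_derivative_continuous_on[OF has_derivative_at_withinI[OF D]] by simp
  case (Suc k)
  have "(\<lambda>x. flat_exp m (x \<bullet> e + c)) differentiable_on UNIV"
    using D by (auto simp: differentiable_on_def differentiable_def)
  moreover have "Ck_on k (\<lambda>x. (b \<bullet> e) * (flat_exp (m + 2) (x \<bullet> e + c)
       + (- real m) * flat_exp (m + 1) (x \<bullet> e + c))) UNIV" for b
    by (intro Ck_on_add Ck_on_mult Ck_on_const Suc)
  ultimately show ?case by (simp add: frechet_derivative_unique[OF D])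
qed

text \<open>The parameter \<open>n\<close> sharpens the bump: since \<open>exp (- 1 / (n t))\<close> is the \<open>n\<close>-th root of \<open>exp (- 1 / t)\<close>, the
  function is for \<open>n > 0\<close> the \<open>n\<close>-th root of the bump for \<open>n = 1\<close>, stays between \<open>0\<close> and \<open>1\<close>, and converges to the
  indicator of the open box. The arguments are written as affine functions of \<open>x\<close> to match
  \<open>Ck_on_flat_exp_affine\<close>.\<close>
definition box_bump :: "'a::euclidean_space \<Rightarrow> 'a \<Rightarrow> nat \<Rightarrow> 'a \<Rightarrow> real" where
  "box_bump a b n x =
    (\<Prod>i\<in>Basis. flat_exp 0 (x \<bullet> (real n *\<^sub>R i) + - real n * (a \<bullet> i)) *
                 flat_exp 0 (x \<bullet> (- real n *\<^sub>R i) + real n * (b \<bullet> i)))"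

lemma box_bump_smooth: "Ck_on k (box_bump a b n) UNIV"
  unfolding box_bump_def[abs_def] by (intro Ck_on_prod Ck_on_mult Ck_on_flat_exp_affine)

lemma flat_exp_0_bounds: "0 \<le> flat_exp 0 t" "flat_exp 0 t \<le> 1"
  by (auto simp: flat_exp_def)

lemma box_bump_bounds: "0 \<le> box_bump a b n x" "box_bump a b n x \<le> 1"
  unfolding box_bump_def
  by (intro prod_nonneg ballI mult_nonneg_nonneg prod_le_1 conjI mult_le_one flat_exp_0_bounds)+

lemma box_bump_pos: "x \<in> box a b \<Longrightarrow> 0 < n \<Longrightarrow> 0 < box_bump a b n x"
  by (auto simp: box_bump_def flat_exp_def mem_box right_diff_distrib[symmetric] not_le
      intro!: prod_pos)

lemma box_bump_outside: "x \<notin> box a b \<Longrightarrow> box_bump a b n x = 0"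
proof -
  assume "x \<notin> box a b"
  then obtain i where "i \<in> Basis" "x \<bullet> i \<le> a \<bullet> i \<or> b \<bullet> i \<le> x \<bullet> i"
    by (auto simp: mem_box not_less)
  then show ?thesis
    by (auto simp: box_bump_def flat_exp_def intro!: prod_zero bexI[of _ i] mult_left_mono)
qed

lemma box_bump_tendsto: "(\<lambda>n. box_bump a b n x) \<longlonglongrightarrow> indicator (box a b) x"
proof (cases "x \<in> box a b")
  case True
  have lim: "(\<lambda>n. flat_exp 0 (t * real n)) \<longlonglongrightarrow> 1" if "0 < t" for t
  proof -
    have "(\<lambda>n. - 1 / (t * real n)) \<longlonglongrightarrow> 0"
      using that by (intro tendsto_divide_0[OF tendsto_const] filterlim_at_top_imp_at_infinity
         filterlim_tendsto_pos_mult_at_top[OF tendsto_const] filterlim_real_sequentially)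
    then have "(\<lambda>n. exp (- 1 / (t * real n))) \<longlonglongrightarrow> 1"
      using tendsto_exp by fastforce
    then show ?thesis
      by (rule Lim_transform_eventually)
         (use that in \<open>auto simp: flat_exp_def eventually_sequentially mult_le_0_iff intro!: exI[of _ 1]\<close>)
  qed
  have "(\<lambda>n. \<Prod>i\<in>Basis. flat_exp 0 ((x \<bullet> i - a \<bullet> i) * real n) * flat_exp 0 ((b \<bullet> i - x \<bullet> i) * real n))
      \<longlonglongrightarrow> (\<Prod>i\<in>(Basis::'a set). 1 * 1)"
    using True by (intro tendsto_prod tendsto_mult lim) (auto simp: mem_box)
  then show ?thesis using True by (simp add: box_bump_def[abs_def] right_diff_distrib algebra_simps)
qed (simp add: box_bump_outside)

lemma box_bump_test_function:
  assumes "cbox a b \<subseteq> \<Omega>"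
  shows "box_bump a b n \<in> test_functions \<Omega>"
proof -
  have "closure {x. box_bump a b n x \<noteq> 0} \<subseteq> cbox a b"
    using box_bump_outside[of _ a b n] box_subset_cbox[of a b]
    by (intro closure_minimal closed_cbox) blast
  moreover have "compact (closure {x. box_bump a b n x \<noteq> 0})"
    using calculation bounded_subset[OF bounded_cbox] compact_eq_bounded_closed by blast
  ultimately show ?thesis using assms box_bump_smooth by (auto simp: test_functions_def)
qed

lemma test_functions_add:
  assumes "\<phi> \<in> test_functions \<Omega>" "\<psi> \<in> test_functions \<Omega>"
  shows "(\<lambda>x. \<phi> x + \<psi> x) \<in> test_functions \<Omega>"
proof -
  let ?A = "closure {x. \<phi> x \<noteq> 0}" and ?B = "closure {x. \<psi> x \<noteq> 0}"
  have "closure {x. \<phi> x + \<psi> x \<noteq> 0} \<subseteq> closure ({x. \<phi> x \<noteq> 0} \<union> {x. \<psi> x \<noteq> 0})"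
    by (intro closure_mono) auto
  then have sub: "closure {x. \<phi> x + \<psi> x \<noteq> 0} \<subseteq> ?A \<union> ?B" by (simp add: closure_Un)
  moreover have "compact (?A \<union> ?B)" using assms by (auto simp: test_functions_def)
  ultimately have "compact (closure {x. \<phi> x + \<psi> x \<noteq> 0})"
    by (meson closed_closure compact_Int_closed inf.absorb_iff2 compact_eq_bounded_closed bounded_subset)
  with sub assms show ?thesis by (auto simp: test_functions_def intro: Ck_on_add)
qed

lemma test_functions_cmult:
  assumes "\<phi> \<in> test_functions \<Omega>"
  shows "(\<lambda>x. c * \<phi> x) \<in> test_functions \<Omega>"
proof -
  have sub: "closure {x. c * \<phi> x \<noteq> 0} \<subseteq> closure {x. \<phi> x \<noteq> 0}" by (intro closure_mono) auto
  then have "compact (closure {x. c * \<phi> x \<noteq> 0})" using assms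
    by (auto simp: test_functions_def compact_eq_bounded_closed intro: bounded_subset)
  with sub assms show ?thesis by (auto simp: test_functions_def intro!: Ck_on_mult Ck_on_const)
qed

lemma test_functions_mono: "U \<subseteq> \<Omega> \<Longrightarrow> \<phi> \<in> test_functions U \<Longrightarrow> \<phi> \<in> test_functions \<Omega>"
  by (auto simp: test_functions_def)

lemma grad_eqI:
  assumes "(f has_derivative (\<lambda>h. g \<bullet> h)) (at x)"
  shows "grad f x = g"
  using frechet_derivative_unique[OF assms] by (simp add: grad_def euclidean_representation)

lemma test_function_has_derivative:
  assumes "\<phi> \<in> test_functions \<Omega>"
  shows "(\<phi> has_derivative (\<lambda>h. grad \<phi> x \<bullet> h)) (at x)"
proof -
  from assms have "Ck_on (Suc 0) \<phi> UNIV" by (simp only: test_functions_def mem_Collect_eq)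
  then have d: "(\<phi> has_derivative frechet_derivative \<phi> (at x)) (at x)"
    by (auto intro: differentiable_on_UNIV_has_derivative)
  then interpret linear "frechet_derivative \<phi> (at x)" by (rule has_derivative_linear)
  have "frechet_derivative \<phi> (at x) h = grad \<phi> x \<bullet> h" for h
  proof -
    have "frechet_derivative \<phi> (at x) h = frechet_derivative \<phi> (at x) (\<Sum>b\<in>Basis. (h \<bullet> b) *\<^sub>R b)"
      by (simp add: euclidean_representation)
    also have "\<dots> = grad \<phi> x \<bullet> h"
      by (simp add: sum scale grad_def inner_sum_left inner_commute[of h] mult.commute)
    finally show ?thesis .
  qed
  then have "frechet_derivative \<phi> (at x) = (\<lambda>h. grad \<phi> x \<bullet> h)" by (rule ext)
  with d show ?thesis by simp
qed

lemma test_function_continuous: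
  assumes "\<phi> \<in> test_functions \<Omega>"
  shows "continuous_on UNIV \<phi>" "continuous_on UNIV (grad \<phi>)"
proof -
  from assms have "Ck_on 0 \<phi> UNIV" "Ck_on (Suc 0) \<phi> UNIV"
    by (simp_all only: test_functions_def mem_Collect_eq)
  then show "continuous_on UNIV \<phi>" "continuous_on UNIV (grad \<phi>)"
    by (auto simp: grad_def[abs_def] intro!: continuous_intros)
qed

text \<open>The complement of the support is open, so not only the function but also its gradient vanishes there.\<close>
lemma test_function_outside:
  assumes "x \<notin> closure {x. \<phi> x \<noteq> 0}"
  shows "\<phi> x = 0" "grad \<phi> x = 0"
proof -
  have z: "\<phi> y = 0" if "y \<notin> closure {x. \<phi> x \<noteq> 0}" for y
    using that subsetD[OF closure_subset, of y "{x. \<phi> x \<noteq> 0}"] by blast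
  then show "\<phi> x = 0" using assms by blast
  have "((\<lambda>x. 0) has_derivative (\<lambda>h. 0)) (at x)" by simp
  then have "(\<phi> has_derivative (\<lambda>h. 0)) (at x)"
  proof (rule has_derivative_transform_within_open)
    show "open (- closure {x. \<phi> x \<noteq> 0})" by (rule open_Compl) (rule closed_closure)
    show "x \<in> - closure {x. \<phi> x \<noteq> 0}" using assms by blast
    show "0 = \<phi> y" if "y \<in> - closure {x. \<phi> x \<noteq> 0}" for y
      by (rule z[OF ComplD[OF that], symmetric])
  qed
  then show "grad \<phi> x = 0" by (intro grad_eqI) simp
qed

lemma test_function_outside_domain:
  assumes "\<phi> \<in> test_functions \<Omega>" "x \<notin> \<Omega>"
  shows "\<phi> x = 0" "grad \<phi> x = 0"
  using assms test_function_outside[of x \<phi>] by (auto simp: test_functions_def)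

lemma test_function_bounded:
  assumes "\<phi> \<in> test_functions \<Omega>"
  obtains B where "0 < B" "\<And>x. \<bar>\<phi> x\<bar> \<le> B" "\<And>x. norm (grad \<phi> x) \<le> B"
proof -
  let ?K = "closure {x. \<phi> x \<noteq> 0}"
  have "compact ?K" using assms by (auto simp: test_functions_def)
  then have "bounded (\<phi> ` ?K)" "bounded (grad \<phi> ` ?K)"
    using test_function_continuous[OF assms]
    by (meson compact_continuous_image compact_imp_bounded continuous_on_subset subset_UNIV)+
  then obtain B1 B2 where B: "\<And>x. x \<in> ?K \<Longrightarrow> \<bar>\<phi> x\<bar> \<le> B1" "\<And>x. x \<in> ?K \<Longrightarrow> norm (grad \<phi> x) \<le> B2"
    by (auto simp: bounded_iff)
  let ?B = "\<bar>B1\<bar> + \<bar>B2\<bar> + 1"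
  show ?thesis
  proof
    show "\<bar>\<phi> x\<bar> \<le> ?B" "norm (grad \<phi> x) \<le> ?B" for x
      using B[of x] test_function_outside[of x \<phi>] by (cases "x \<in> ?K"; simp)+
  qed simp
qed

lemma grad_add:
  assumes "\<phi> \<in> test_functions \<Omega>" "\<psi> \<in> test_functions \<Omega>"
  shows "grad (\<lambda>x. \<phi> x + \<psi> x) x = grad \<phi> x + grad \<psi> x"
  using has_derivative_add[OF assms[THEN test_function_has_derivative]]
  by (intro grad_eqI) (simp add: inner_add_left)

lemma grad_cmult:
  assumes "\<phi> \<in> test_functions \<Omega>"
  shows "grad (\<lambda>x. c * \<phi> x) x = c *\<^sub>R grad \<phi> x"
  using has_derivative_mult_right[OF test_function_has_derivative[OF assms], of c]
  by (intro grad_eqI) simp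

lemma test_functions_mult:
  assumes "\<phi> \<in> test_functions \<Omega>" "\<psi> \<in> test_functions \<Omega>"
  shows "(\<lambda>x. \<phi> x * \<psi> x) \<in> test_functions \<Omega>"
proof -
  have sub: "closure {x. \<phi> x * \<psi> x \<noteq> 0} \<subseteq> closure {x. \<phi> x \<noteq> 0}" by (intro closure_mono) auto
  then have "compact (closure {x. \<phi> x * \<psi> x \<noteq> 0})" using assms
    by (auto simp: test_functions_def compact_eq_bounded_closed intro: bounded_subset)
  with sub assms show ?thesis by (auto simp: test_functions_def intro!: Ck_on_mult)
qed

lemma grad_mult:
  assumes "\<phi> \<in> test_functions \<Omega>" "\<psi> \<in> test_functions \<Omega>"
  shows "grad (\<lambda>x. \<phi> x * \<psi> x) x = \<phi> x *\<^sub>R grad \<psi> x + \<psi> x *\<^sub>R grad \<phi> x"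
  using has_derivative_mult[OF assms[THEN test_function_has_derivative]]
  by (intro grad_eqI) (simp add: inner_add_left algebra_simps)

lemma test_function_lipschitz:
  assumes "\<phi> \<in> test_functions \<Omega>" "\<And>x. norm (grad \<phi> x) \<le> B"
  shows "\<bar>\<phi> y - \<phi> x\<bar> \<le> B * norm (y - x)"
proof -
  have "norm (\<phi> y - \<phi> x) \<le> B * norm (y - x)"
  proof (rule differentiable_bound[of UNIV \<phi> "\<lambda>x h. grad \<phi> x \<bullet> h"])
    show "(\<phi> has_derivative (\<bullet>) (grad \<phi> x)) (at x within UNIV)" for x
      using test_function_has_derivative[OF assms(1)] by simp
    show "onorm ((\<bullet>) (grad \<phi> x)) \<le> B" for x
    proof (rule onorm_bound)
      show "0 \<le> B" using assms(2)[of x] norm_ge_zero order_trans by blast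
      show "norm (grad \<phi> x \<bullet> h) \<le> B * norm h" for h
        using Cauchy_Schwarz_ineq2[of "grad \<phi> x" h] mult_right_mono[OF assms(2)[of x], of "norm h"] by simp
    qed
  qed auto
  then show ?thesis by simp
qed

section \<open>Extension of dominated linear functionals\<close>

text \<open>The graph of a linear functional on a subspace. Partial functionals are handled as graphs, so that
  extension is inclusion and Zorn's lemma applies to sets. Single-valuedness is a consequence of
  domination by a sublinear functional.\<close>
definition linear_graph :: "(('a \<Rightarrow> real) \<times> real) set \<Rightarrow> bool" where
  "linear_graph H \<longleftrightarrow>
     (\<forall>f r g s c. (f, r) \<in> H \<and> (g, s) \<in> H \<longrightarrow> ((\<lambda>x. f x + c * g x), r + c * s) \<in> H)"

lemma linear_graphD:
  "linear_graph H \<Longrightarrow> (f, r) \<in> H \<Longrightarrow> (g, s) \<in> H \<Longrightarrow> ((\<lambda>x. f x + c * g x), r + c * s) \<in> H"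
  by (auto simp: linear_graph_def)

text \<open>Functions are combined pointwise, and the space is an explicit set closed under linear combinations,
  so that the functions integrable for a given measure are covered.\<close>
locale sublinear_on =
  fixes E :: "('a \<Rightarrow> real) set" and S :: "('a \<Rightarrow> real) \<Rightarrow> real"
  assumes E_lin: "\<And>f g c. f \<in> E \<Longrightarrow> g \<in> E \<Longrightarrow> (\<lambda>x. f x + c * g x) \<in> E"
    and S_add: "\<And>f g. f \<in> E \<Longrightarrow> g \<in> E \<Longrightarrow> S (\<lambda>x. f x + g x) \<le> S f + S g"
    and S_scale: "\<And>f c. f \<in> E \<Longrightarrow> 0 < c \<Longrightarrow> S (\<lambda>x. c * f x) = c * S f"
begin

definition dominated :: "(('a \<Rightarrow> real) \<times> real) set \<Rightarrow> bool" where
  "dominated H \<longleftrightarrow> linear_graph H \<and> (\<forall>(f, r)\<in>H. f \<in> E \<and> r \<le> S f)"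

text \<open>The one-dimensional step. A value \<open>s\<close> for \<open>g\<close> is admissible when it lies between
  \<open>r - S (f - g)\<close> and \<open>S (f + g) - r\<close> for all \<open>(f, r)\<close> in the graph; subadditivity puts every lower
  bound below every upper bound, and the supremum of the lower bounds is chosen.\<close>
lemma dominated_extend:
  assumes H: "dominated H" "H \<noteq> {}" and g: "g \<in> E"
  obtains s where "dominated {((\<lambda>x. f x + c * g x), r + c * s) | f r c. (f, r) \<in> H}"
proof -
  have lin: "linear_graph H" and HE: "\<And>f r. (f, r) \<in> H \<Longrightarrow> f \<in> E"
    and HS: "\<And>f r. (f, r) \<in> H \<Longrightarrow> r \<le> S f"
    using H by (auto simp: dominated_def)
  have Eadd: "(\<lambda>x. f x + h x) \<in> E" if "f \<in> E" "h \<in> E" for f h using E_lin[OF that, of 1] by simp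
  have Esub: "(\<lambda>x. f x - h x) \<in> E" if "f \<in> E" "h \<in> E" for f h using E_lin[OF that, of "-1"] by simp
  have key: "r - S (\<lambda>x. f x - g x) \<le> S (\<lambda>x. f' x + g x) - r'" if "(f, r) \<in> H" "(f', r') \<in> H" for f r f' r'
  proof -
    have "(\<lambda>x. f x + 1 * f' x, r + 1 * r') \<in> H" by (rule linear_graphD[OF lin that])
    from HS[OF this] have "r + r' \<le> S (\<lambda>x. (f x - g x) + (f' x + g x))" by simp
    also have "\<dots> \<le> S (\<lambda>x. f x - g x) + S (\<lambda>x. f' x + g x)"
      using that g HE by (intro S_add Esub Eadd) auto
    finally show ?thesis by simp
  qed
  obtain f0 r0 where fr0: "(f0, r0) \<in> H" using H by auto
  \<comment> \<open>the largest lower bound forced on the value at \<open>g\<close>\<close>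
  define s where "s = (SUP (f, r)\<in>H. r - S (\<lambda>x. f x - g x))"
  have bdd: "bdd_above ((\<lambda>(f, r). r - S (\<lambda>x. f x - g x)) ` H)"
    using key[OF _ fr0] by (intro bdd_aboveI2[where M="S (\<lambda>x. f0 x + g x) - r0"]) auto
  have lower: "r - S (\<lambda>x. f x - g x) \<le> s" if "(f, r) \<in> H" for f r
    unfolding s_def using cSUP_upper[OF that bdd] by simp
  have upper: "s \<le> S (\<lambda>x. f x + g x) - r" if "(f, r) \<in> H" for f r
    unfolding s_def using key[OF _ that] H by (intro cSUP_least) auto
  have scale: "((\<lambda>x. c * f x), c * r) \<in> H" if "(f, r) \<in> H" for f r c
    using linear_graphD[OF lin that that, of "c - 1"] by (simp add: algebra_simps)
  have bound: "r + c * s \<le> S (\<lambda>x. f x + c * g x)" if fr: "(f, r) \<in> H" for f r c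
  proof -
    consider "c = 0" | "c > 0" | "c < 0" by linarith
    then show ?thesis
    proof cases
      case 1 then show ?thesis using HS[OF fr] by simp
    next
      case 2
      have "s \<le> S (\<lambda>x. inverse c * f x + g x) - inverse c * r" by (rule upper[OF scale[OF fr]])
      then have "c * s \<le> c * (S (\<lambda>x. inverse c * f x + g x) - inverse c * r)" using 2 by simp
      also have "\<dots> = S (\<lambda>x. c * (inverse c * f x + g x)) - r"
        using 2 g HE[OF scale[OF fr]] by (subst S_scale) (auto intro: Eadd simp: algebra_simps)
      also have "(\<lambda>x. c * (inverse c * f x + g x)) = (\<lambda>x. f x + c * g x)"
        using 2 by (auto simp: algebra_simps)
      finally show ?thesis by simp
    next
      case 3
      define d where "d = - c"
      then have d: "d > 0" using 3 by simp
      have "inverse d * r - S (\<lambda>x. inverse d * f x - g x) \<le> s" by (rule lower[OF scale[OF fr]])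
      then have "d * (inverse d * r - S (\<lambda>x. inverse d * f x - g x)) \<le> d * s" using d by simp
      moreover have "d * (inverse d * r - S (\<lambda>x. inverse d * f x - g x)) = r - S (\<lambda>x. d * (inverse d * f x - g x))"
        using d g HE[OF scale[OF fr]] by (subst S_scale) (auto intro: Esub simp: algebra_simps)
      moreover have "(\<lambda>x. d * (inverse d * f x - g x)) = (\<lambda>x. f x + c * g x)"
        using d by (auto simp: algebra_simps d_def)
      ultimately show ?thesis by (simp add: d_def)
    qed
  qed
  have "linear_graph {((\<lambda>x. f x + c * g x), r + c * s) | f r c. (f, r) \<in> H}"
    (is "linear_graph ?X")
    unfolding linear_graph_def
  proof (intro allI impI)
    fix F \<rho> F' \<rho>' d assume "(F, \<rho>) \<in> ?X \<and> (F', \<rho>') \<in> ?X"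
    then obtain f r c f' r' c' where F: "(f, r) \<in> H" "F = (\<lambda>x. f x + c * g x)" "\<rho> = r + c * s"
      and F': "(f', r') \<in> H" "F' = (\<lambda>x. f' x + c' * g x)" "\<rho>' = r' + c' * s" by blast
    have "((\<lambda>x. f x + d * f' x), r + d * r') \<in> H" by (rule linear_graphD[OF lin F(1) F'(1)])
    then show "((\<lambda>x. F x + d * F' x), \<rho> + d * \<rho>') \<in> ?X"
      unfolding F F' mem_Collect_eq
      by (intro exI[of _ "\<lambda>x. f x + d * f' x"] exI[of _ "r + d * r'"] exI[of _ "c + d * c'"])
         (auto simp: algebra_simps)
  qed
  then have "dominated {((\<lambda>x. f x + c * g x), r + c * s) | f r c. (f, r) \<in> H}"
    using bound HE g by (auto simp: dominated_def intro: E_lin)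
  then show ?thesis by (rule that)
qed

theorem hahn_banach:
  assumes T: "T \<subseteq> E" "T \<noteq> {}" "\<And>f g c. f \<in> T \<Longrightarrow> g \<in> T \<Longrightarrow> (\<lambda>x. f x + c * g x) \<in> T"
    and L: "\<And>f g c. f \<in> T \<Longrightarrow> g \<in> T \<Longrightarrow> L (\<lambda>x. f x + c * g x) = L f + c * L g"
    and LS: "\<And>f. f \<in> T \<Longrightarrow> L f \<le> S f"
  obtains L' where "\<And>f. f \<in> T \<Longrightarrow> L' f = L f"
    and "\<And>f g c. f \<in> E \<Longrightarrow> g \<in> E \<Longrightarrow> L' (\<lambda>x. f x + c * g x) = L' f + c * L' g"
    and "\<And>f. f \<in> E \<Longrightarrow> L' f \<le> S f"
proof -
  define G0 where "G0 = {(f, L f) | f. f \<in> T}"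
  define \<A> where "\<A> = {H. dominated H \<and> G0 \<subseteq> H}"
  have G0: "dominated G0" "G0 \<noteq> {}"
    using T L LS by (auto simp: G0_def dominated_def linear_graph_def)
  have "\<exists>M\<in>\<A>. \<forall>X\<in>\<A>. M \<subseteq> X \<longrightarrow> X = M"
  proof (rule subset_Zorn_nonempty)
    show "\<A> \<noteq> {}" using G0 by (auto simp: \<A>_def)
  next
    fix C assume C: "C \<noteq> {}" "subset.chain \<A> C"
    then have sub: "C \<subseteq> \<A>" and tot: "\<And>A B. A \<in> C \<Longrightarrow> B \<in> C \<Longrightarrow> A \<subseteq> B \<or> B \<subseteq> A"
      by (auto simp: subset_chain_def)
    have "linear_graph (\<Union>C)"
      unfolding linear_graph_def
    proof (intro allI impI, elim conjE UnionE)
      fix f g :: "'a \<Rightarrow> real" and r s c A B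
      assume "(f, r) \<in> A" "A \<in> C" "(g, s) \<in> B" "B \<in> C"
      then obtain D where "D \<in> C" "(f, r) \<in> D" "(g, s) \<in> D" using tot by blast
      moreover from this have "linear_graph D" using sub by (auto simp: \<A>_def dominated_def)
      ultimately show "((\<lambda>x. f x + c * g x), r + c * s) \<in> \<Union>C" using linear_graphD by blast
    qed
    then show "\<Union>C \<in> \<A>" using C sub by (auto simp: \<A>_def dominated_def; blast)
  qed
  then obtain M where M: "M \<in> \<A>" and max: "\<And>X. X \<in> \<A> \<Longrightarrow> M \<subseteq> X \<Longrightarrow> X = M" by blast
  have dom: "dominated M" and G0M: "G0 \<subseteq> M" and lin: "linear_graph M" using M by (auto simp: \<A>_def dominated_def)
  have MS: "\<And>f r. (f, r) \<in> M \<Longrightarrow> r \<le> S f" and ME: "\<And>f r. (f, r) \<in> M \<Longrightarrow> f \<in> E"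
    using dom by (auto simp: dominated_def)
  obtain f0 r0 where fr0: "(f0, r0) \<in> M" using G0 G0M by auto
  have zero: "((\<lambda>x. 0), 0) \<in> M" using linear_graphD[OF lin fr0 fr0, of "-1"] by simp
  have total: "\<exists>r. (g, r) \<in> M" if g: "g \<in> E" for g
  proof -
    obtain s where s: "dominated {((\<lambda>x. f x + c * g x), r + c * s) | f r c. (f, r) \<in> M}" (is "dominated ?X")
      using dominated_extend[OF dom _ g] zero by blast
    have "M \<subseteq> ?X" by (force intro: exI[of _ 0])
    with s G0M max[of ?X] have "?X = M" by (auto simp: \<A>_def)
    moreover have "((\<lambda>x. 0 + 1 * g x), 0 + 1 * s) \<in> ?X"
      unfolding mem_Collect_eq using zero by (intro exI[of _ "\<lambda>x. 0"] exI[of _ 0] exI[of _ 1]) auto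
    ultimately show ?thesis by auto
  qed
  \<comment> \<open>two values at \<open>f\<close> would put a positive value at the zero function, where \<open>S\<close> is \<open>0\<close>\<close>
  have unique: "r = s" if "(f, r) \<in> M" "(f, s) \<in> M" for f r s
  proof -
    have "r' \<le> s'" if "(f, r') \<in> M" "(f, s') \<in> M" for r' s'
    proof (rule ccontr)
      assume less: "\<not> r' \<le> s'"
      have z: "((\<lambda>x. 0), r' - s') \<in> M" using linear_graphD[OF lin that, of "-1"] by simp
      have "S (\<lambda>x. 2 * 0) = 2 * S (\<lambda>x. 0)" by (rule S_scale[OF ME[OF zero]]) simp
      then have "S (\<lambda>x. 0) = 0" by simp
      with MS[OF z] less show False by simp
    qed
    with that show ?thesis by (auto intro: antisym)
  qed
  define L' where "L' f = (THE r. (f, r) \<in> M)" for f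
  have L'_eq: "L' f = r" if "(f, r) \<in> M" for f r
    using that unique unfolding L'_def by blast
  have L'_mem: "(f, L' f) \<in> M" if "f \<in> E" for f using total[OF that] L'_eq by auto
  show ?thesis
  proof
    show "L' f = L f" if "f \<in> T" for f using that G0M by (intro L'_eq) (auto simp: G0_def)
    show "L' (\<lambda>x. f x + c * g x) = L' f + c * L' g" if "f \<in> E" "g \<in> E" for f g c
      by (rule L'_eq[OF linear_graphD[OF lin L'_mem[OF that(1)] L'_mem[OF that(2)]]])
    show "L' f \<le> S f" if "f \<in> E" for f using MS[OF L'_mem[OF that]] .
  qed
qed

end

section \<open>From dominated functionals to measures\<close>

text \<open>A linear functional below \<open>\<integral> max f 0 dM\<close> is given by a measure below \<open>M\<close>. The Hahn-Banach
  extension is defined on indicators of measurable sets, the bound makes it positive and dominated by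
  \<open>M\<close>, and domination yields continuity at the empty set, hence countable additivity.\<close>
lemma dominated_functional_measure:
  fixes L :: "('a \<Rightarrow> real) \<Rightarrow> real"
  assumes fin: "finite_measure M"
    and T: "\<And>f. f \<in> T \<Longrightarrow> integrable M f" "T \<noteq> {}"
      "\<And>f g c. f \<in> T \<Longrightarrow> g \<in> T \<Longrightarrow> (\<lambda>x. f x + c * g x) \<in> T"
    and L: "\<And>f g c. f \<in> T \<Longrightarrow> g \<in> T \<Longrightarrow> L (\<lambda>x. f x + c * g x) = L f + c * L g"
    and LM: "\<And>f. f \<in> T \<Longrightarrow> L f \<le> (LINT x|M. max (f x) 0)"
  obtains \<nu> where "sets \<nu> = sets M" "\<And>A. A \<in> sets M \<Longrightarrow> emeasure \<nu> A \<le> emeasure M A"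
    and "\<And>f :: 'a \<Rightarrow> real. integrable M f \<Longrightarrow> integrable \<nu> f"
    and "\<And>f. f \<in> T \<Longrightarrow> (LINT x|\<nu>. f x) = L f"
proof -
  interpret finite_measure M by (rule fin)
  interpret sublinear_on "{f. integrable M f}" "\<lambda>f. LINT x|M. max (f x) 0"
  proof
    show "(\<lambda>x. f x + c * g x) \<in> {f. integrable M f}"
      if "f \<in> {f. integrable M f}" "g \<in> {f. integrable M f}" for f g :: "'a \<Rightarrow> real" and c
      using that by auto
    show "(LINT x|M. max (f x + g x) 0) \<le> (LINT x|M. max (f x) 0) + (LINT x|M. max (g x) 0)"
      if "f \<in> {f. integrable M f}" "g \<in> {f. integrable M f}" for f g :: "'a \<Rightarrow> real"
    proof -
      have "(LINT x|M. max (f x + g x) 0) \<le> (LINT x|M. max (f x) 0 + max (g x) 0)"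
        using that by (intro integral_mono integrable_max) auto
      then show ?thesis using that by simp
    qed
    show "(LINT x|M. max (c * f x) 0) = c * (LINT x|M. max (f x) 0)" if "0 < c" for f :: "'a \<Rightarrow> real" and c
    proof -
      have "(LINT x|M. max (c * f x) 0) = (LINT x|M. c * max (f x) 0)"
        using that by (intro Bochner_Integration.integral_cong) (auto simp: max_def zero_le_mult_iff mult_le_0_iff)
      then show ?thesis by simp
    qed
  qed
  have TE: "T \<subseteq> {f. integrable M f}" using T(1) by blast
  obtain K where K: "\<And>f. f \<in> T \<Longrightarrow> K f = L f"
    and "\<And>f g c. f \<in> {f. integrable M f} \<Longrightarrow> g \<in> {f. integrable M f} \<Longrightarrow> K (\<lambda>x. f x + c * g x) = K f + c * K g"
    and "\<And>f. f \<in> {f. integrable M f} \<Longrightarrow> K f \<le> (LINT x|M. max (f x) 0)"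
    by (rule hahn_banach[OF TE T(2,3) L LM]) (assumption | blast)+
  then have K_lin: "\<And>f g c. integrable M f \<Longrightarrow> integrable M g \<Longrightarrow> K (\<lambda>x. f x + c * g x) = K f + c * K g"
    and K_le: "\<And>f. integrable M f \<Longrightarrow> K f \<le> (LINT x|M. max (f x) 0)" by auto
  have K_zero: "K (\<lambda>x. 0) = 0" using K_lin[of "\<lambda>x. 0" "\<lambda>x. 0" 1] by simp
  have K_scale: "K (\<lambda>x. c * f x) = c * K f" if "integrable M f" for f c
    using K_lin[of "\<lambda>x. 0" f c] that K_zero by simp
  have K_add: "K (\<lambda>x. f x + g x) = K f + K g" if "integrable M f" "integrable M g" for f g
    using K_lin[OF that, of 1] by simp
  have K_nonneg: "0 \<le> K f" if f: "integrable M f" and "\<And>x. 0 \<le> f x" for f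
  proof -
    have "K (\<lambda>x. - 1 * f x) \<le> (LINT x|M. max (- 1 * f x) 0)" using f by (intro K_le) auto
    also have "\<dots> = 0" using that(2) by (simp add: max_def)
    finally show ?thesis using K_scale[OF f, of "-1"] by simp
  qed
  have K_bound: "\<bar>K f\<bar> \<le> (LINT x|M. \<bar>f x\<bar>)" if f: "integrable M f" for f
  proof -
    have "K f \<le> (LINT x|M. \<bar>f x\<bar>)"
      using f by (intro order_trans[OF K_le[OF f]] integral_mono) auto
    moreover have "K (\<lambda>x. - 1 * f x) \<le> (LINT x|M. \<bar>f x\<bar>)"
      using f by (intro order_trans[OF K_le] integral_mono) auto
    ultimately show ?thesis using K_scale[OF f, of "-1"] by simp
  qed
  define m where "m A = ennreal (K (indicator A))" for A
  define \<nu> where "\<nu> = measure_of (space M) (sets M) m"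
  have ind: "integrable M (indicator A :: 'a \<Rightarrow> real)" if "A \<in> sets M" for A
    using that emeasure_finite by (simp add: less_top[symmetric])
  have m_le: "m A \<le> emeasure M A" if "A \<in> sets M" for A
  proof -
    have "K (indicator A) \<le> (LINT x|M. indicator A x)"
      using K_le[OF ind[OF that]] by (simp add: max_absorb1)
    also have "\<dots> = measure M A" using that by simp
    finally show ?thesis by (simp add: m_def emeasure_eq_measure ennreal_leI)
  qed
  have "(indicator {} :: 'a \<Rightarrow> real) = (\<lambda>x. 0)" by auto
  then have pos: "positive (sets M) m" by (simp add: positive_def m_def K_zero)
  have add: "additive (sets M) m"
    unfolding additive_def
  proof (intro ballI impI)
    fix A B assume AB: "A \<in> sets M" "B \<in> sets M" "A \<inter> B = {}"
    have "K (indicator (A \<union> B)) = K (\<lambda>x. indicator A x + indicator B x)"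
      using AB by (intro arg_cong[of _ _ K]) (auto simp: indicator_def fun_eq_iff)
    also have "\<dots> = K (indicator A) + K (indicator B)" using AB by (intro K_add ind)
    finally show "m (A \<union> B) = m A + m B"
      unfolding m_def using AB by (subst ennreal_plus[symmetric]) (auto intro!: K_nonneg ind)
  qed
  have "countably_additive (sets M) m"
  proof (rule sets.empty_continuous_imp_countably_additive[OF pos add])
    show "\<forall>A\<in>sets M. m A \<noteq> \<infinity>" by (simp add: m_def)
    fix A :: "nat \<Rightarrow> 'a set" assume A: "range A \<subseteq> sets M" "decseq A" "(\<Inter>i. A i) = {}"
    have "(\<lambda>i. emeasure M (A i)) \<longlonglongrightarrow> 0" using Lim_emeasure_decseq[OF A(1,2)] A(3) by simp
    moreover have "m (A i) \<le> emeasure M (A i)" for i using A(1) by (intro m_le) auto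
    ultimately show "(\<lambda>i. m (A i)) \<longlonglongrightarrow> 0"
      by (intro tendsto_sandwich[of "\<lambda>_. 0" "\<lambda>i. m (A i)" sequentially "\<lambda>i. emeasure M (A i)"]) simp_all
  qed
  then have \<nu>: "emeasure \<nu> A = m A" if "A \<in> sets M" for A
    using pos that by (intro emeasure_measure_of[OF \<nu>_def sets.space_closed]) (auto simp: \<nu>_def)
  have sets\<nu>[measurable_cong]: "sets \<nu> = sets M" by (simp add: \<nu>_def)
  then have space\<nu>: "space \<nu> = space M" by (rule sets_eq_imp_space_eq)
  have le: "\<nu> \<le> M" using m_le \<nu> by (simp add: le_measure sets\<nu>)
  have int: "integrable \<nu> f" if "integrable M f" for f :: "'a \<Rightarrow> real"
    using that nn_integral_mono_measure[OF sets\<nu> le, of "\<lambda>x. norm (f x)"]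
    by (auto simp: integrable_iff_bounded measurable_cong_sets[OF sets\<nu> refl] intro: le_less_trans)
  have "(LINT x|\<nu>. f x) = K f" if "integrable M f" for f
    using that
  proof (induction rule: integrable_induct)
    case (base A c)
    have "K (\<lambda>x. c * indicator A x) = c * measure \<nu> A"
      using base K_nonneg[OF ind[OF base(1)]] by (simp add: K_scale ind measure_def \<nu> m_def)
    then show ?case using base by (simp add: sets\<nu> space\<nu> mult.commute)
  next
    case (add f g)
    then show ?case by (simp add: int K_add)
  next
    case (lim f s)
    have s: "\<And>i. integrable M (s i)" and f: "integrable M f"
      and IH: "\<And>i. (LINT x|\<nu>. s i x) = K (s i)"
      and conv: "\<And>x. x \<in> space M \<Longrightarrow> (\<lambda>i. s i x) \<longlonglongrightarrow> f x"
      and bd: "\<And>x i. x \<in> space M \<Longrightarrow> norm (s i x) \<le> 2 * norm (f x)"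
      by (fact lim)+
    have "(\<lambda>i. LINT x|\<nu>. s i x) \<longlonglongrightarrow> (LINT x|\<nu>. f x)"
      by (rule integral_dominated_convergence[where w="\<lambda>x. 2 * norm (f x)"])
         (use s f conv bd int in \<open>auto simp: space\<nu>\<close>)
    moreover have "(\<lambda>i. K (s i)) \<longlonglongrightarrow> K f"
    proof -
      have "(\<lambda>i. LINT x|M. \<bar>f x - s i x\<bar>) \<longlonglongrightarrow> (LINT x|M. 0)"
      proof (rule integral_dominated_convergence[where w="\<lambda>x. 3 * norm (f x)"])
        show "AE x in M. (\<lambda>i. \<bar>f x - s i x\<bar>) \<longlonglongrightarrow> 0"
        proof (rule AE_I2)
          fix x assume "x \<in> space M"
          from tendsto_rabs[OF tendsto_diff[OF tendsto_const conv[OF this]], of "f x"]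
          show "(\<lambda>i. \<bar>f x - s i x\<bar>) \<longlonglongrightarrow> 0" by simp
        qed
        show "AE x in M. norm \<bar>f x - s i x\<bar> \<le> 3 * norm (f x)" for i
        proof (rule AE_I2)
          fix x assume "x \<in> space M"
          from bd[OF this, of i] show "norm \<bar>f x - s i x\<bar> \<le> 3 * norm (f x)" by simp
        qed
      qed (use s f in auto)
      then have "(\<lambda>i. LINT x|M. \<bar>f x - s i x\<bar>) \<longlonglongrightarrow> 0" by simp
      then have "(\<lambda>i. K f - K (s i)) \<longlonglongrightarrow> 0"
      proof (rule Lim_null_comparison[rotated], intro always_eventually allI)
        fix i
        have "K f - K (s i) = K (\<lambda>x. f x - s i x)" using K_lin[OF f s, of "-1" i] by simp
        then show "norm (K f - K (s i)) \<le> (LINT x|M. \<bar>f x - s i x\<bar>)"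
          using K_bound[of "\<lambda>x. f x - s i x"] s f by simp
      qed
      then show ?thesis using tendsto_diff[OF tendsto_const[of "K f"]] by fastforce
    qed
    ultimately show ?case using LIMSEQ_unique by (simp add: IH)
  qed
  with K T(1) have "(LINT x|\<nu>. f x) = L f" if "f \<in> T" for f using that by simp
  with m_le \<nu> int sets\<nu> show ?thesis by (intro that[of \<nu>]) auto
qed

text \<open>Inner regularity is known for finite Borel measures on the whole space, so the measure is pushed
  forward along the inclusion of the open set; compact subsets of a subset of \<open>\<Omega>\<close> are the same for both.\<close>
lemma finite_measure_imp_radon_measure_on:
  fixes \<mu> :: "'a::euclidean_space measure"
  assumes \<Omega>: "open \<Omega>" and sets: "sets \<mu> = sets (restrict_space borel \<Omega>)" and fin: "finite_measure \<mu>"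
  shows "radon_measure_on \<Omega> \<mu>"
proof -
  interpret finite_measure \<mu> by (rule fin)
  have sp: "space \<mu> = \<Omega>" using sets_eq_imp_space_eq[OF sets] by (simp add: space_restrict_space)
  have mem: "A \<in> sets \<mu> \<longleftrightarrow> A \<in> sets borel \<and> A \<subseteq> \<Omega>" for A
    using \<Omega> by (auto simp: sets sets_restrict_space_iff)
  have id: "(\<lambda>x. x) \<in> measurable \<mu> borel"
    unfolding measurable_cong_sets[OF sets refl] by (intro measurable_restrict_space1) simp
  define \<mu>' where "\<mu>' = distr \<mu> borel (\<lambda>x. x)"
  have eq: "emeasure \<mu>' A = emeasure \<mu> A" if "A \<in> sets \<mu>" for A
    using that mem[of A] id by (simp add: \<mu>'_def emeasure_distr sp Int_absorb2)
  have "emeasure \<mu> A = (SUP K\<in>{K. compact K \<and> K \<subseteq> A}. emeasure \<mu> K)" if A: "A \<in> sets \<mu>" for A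
  proof -
    have "emeasure \<mu>' A = (SUP K\<in>{K. K \<subseteq> A \<and> compact K}. emeasure \<mu>' K)"
      using A mem[of A] id
      by (intro inner_regular) (auto simp: \<mu>'_def emeasure_distr emeasure_eq_measure)
    also have "\<dots> = (SUP K\<in>{K. compact K \<and> K \<subseteq> A}. emeasure \<mu> K)"
      using A mem by (intro SUP_cong eq) (auto simp: borel_compact)
    finally show ?thesis using eq[OF A] by simp
  qed
  then show ?thesis by (auto simp: radon_measure_on_def sets less_top[symmetric])
qed

section \<open>The fundamental lemma of the calculus of variations\<close>

lemma integrable_lebesgue_on_superset:
  fixes f :: "'a::euclidean_space \<Rightarrow> 'b::euclidean_space"
  assumes "K \<in> sets lebesgue" "\<Omega> \<in> sets lebesgue" "K \<subseteq> \<Omega>" "\<And>x. x \<in> \<Omega> - K \<Longrightarrow> f x = 0"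
  shows "integrable (lebesgue_on K) f \<longleftrightarrow> integrable (lebesgue_on \<Omega>) f"
    and "(LINT x|lebesgue_on K. f x) = (LINT x|lebesgue_on \<Omega>. f x)"
proof -
  have "(\<lambda>x. indicator K x *\<^sub>R f x) = (\<lambda>x. indicator \<Omega> x *\<^sub>R f x)"
    using assms by (auto simp: indicator_def fun_eq_iff)
  then show "integrable (lebesgue_on K) f \<longleftrightarrow> integrable (lebesgue_on \<Omega>) f"
    "(LINT x|lebesgue_on K. f x) = (LINT x|lebesgue_on \<Omega>. f x)"
    using assms by (simp_all add: integrable_restrict_space integral_restrict_space)
qed

text \<open>Local integrability controls integrals only over compact subsets; a function supported in one of
  them may therefore be integrated over the whole open set.\<close>
lemma integrable_locally_dominated:
  fixes f :: "'a::euclidean_space \<Rightarrow> 'b::euclidean_space" and w :: "'a \<Rightarrow> 'c::euclidean_space"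
  assumes "open \<Omega>" "locally_integrable_on \<Omega> w" "compact K" "K \<subseteq> \<Omega>"
    and "f \<in> borel_measurable (lebesgue_on K)"
    and "\<And>x. x \<in> K \<Longrightarrow> norm (f x) \<le> B * norm (w x)" "\<And>x. x \<notin> K \<Longrightarrow> f x = 0"
  shows "integrable (lebesgue_on \<Omega>) f"
proof -
  have w: "integrable (lebesgue_on K) w" using assms by (auto simp: locally_integrable_on_def)
  have "integrable (lebesgue_on K) f"
  proof (rule Bochner_Integration.integrable_bound)
    show "integrable (lebesgue_on K) (\<lambda>x. B * norm (w x))" using w by auto
    show "AE x in lebesgue_on K. norm (f x) \<le> norm (B * norm (w x))"
      using assms by (intro AE_I2) (force intro: order_trans)
  qed (use assms in auto)
  then show ?thesis
    using assms by (subst integrable_lebesgue_on_superset(1)[symmetric, of K])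
      (auto simp: borel_compact sets_completionI_sets)
qed

lemma measurable_locally_integrable:
  "locally_integrable_on \<Omega> w \<Longrightarrow> compact K \<Longrightarrow> K \<subseteq> \<Omega> \<Longrightarrow> w \<in> borel_measurable (lebesgue_on K)"
  by (auto simp: locally_integrable_on_def)

lemma continuous_UNIV_measurable_lebesgue_on:
  fixes f :: "'a::euclidean_space \<Rightarrow> 'b::euclidean_space"
  shows "continuous_on UNIV f \<Longrightarrow> f \<in> borel_measurable (lebesgue_on S)"
  by (intro measurable_restrict_space1 measurable_completion) 
     (simp add: borel_measurable_continuous_onI)

lemma test_function_measurable:
  assumes "\<phi> \<in> test_functions \<Omega>"
  shows "\<phi> \<in> borel_measurable (lebesgue_on S)" "grad \<phi> \<in> borel_measurable (lebesgue_on S)"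
  using test_function_continuous[OF assms] by (auto intro: continuous_UNIV_measurable_lebesgue_on)

lemma integrable_mult_test:
  fixes w :: "'a::euclidean_space \<Rightarrow> 'b::euclidean_space" and u :: "'a \<Rightarrow> real"
  assumes "open \<Omega>" "\<phi> \<in> test_functions \<Omega>"
  shows "locally_integrable_on \<Omega> w \<Longrightarrow> integrable (lebesgue_on \<Omega>) (\<lambda>x. \<phi> x *\<^sub>R w x)"
    and "locally_integrable_on \<Omega> u \<Longrightarrow> integrable (lebesgue_on \<Omega>) (\<lambda>x. u x *\<^sub>R grad \<phi> x)"
proof -
  let ?K = "closure {x. \<phi> x \<noteq> 0}"
  have K: "compact ?K" "?K \<subseteq> \<Omega>" using assms by (auto simp: test_functions_def)
  obtain B where B: "\<And>x. \<bar>\<phi> x\<bar> \<le> B" "\<And>x. norm (grad \<phi> x) \<le> B"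
    using test_function_bounded[OF assms(2)] by metis
  note [measurable] = test_function_measurable[OF assms(2)]
  have out: "\<phi> x *\<^sub>R w x = 0" "u x *\<^sub>R grad \<phi> x = 0" if "x \<notin> ?K" for x
    using test_function_outside[OF that] by simp_all
  show "integrable (lebesgue_on \<Omega>) (\<lambda>x. \<phi> x *\<^sub>R w x)" if w: "locally_integrable_on \<Omega> w"
  proof (rule integrable_locally_dominated[OF assms(1) w K])
    note [measurable] = measurable_locally_integrable[OF w K]
    show "(\<lambda>x. \<phi> x *\<^sub>R w x) \<in> borel_measurable (lebesgue_on ?K)" by measurable
    show "norm (\<phi> x *\<^sub>R w x) \<le> B * norm (w x)" for x using B by (simp add: mult_right_mono)
  qed (rule out(1))
  show "integrable (lebesgue_on \<Omega>) (\<lambda>x. u x *\<^sub>R grad \<phi> x)" if u: "locally_integrable_on \<Omega> u"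
  proof (rule integrable_locally_dominated[OF assms(1) u K])
    note [measurable] = measurable_locally_integrable[OF u K]
    show "(\<lambda>x. u x *\<^sub>R grad \<phi> x) \<in> borel_measurable (lebesgue_on ?K)" by measurable
    show "norm (u x *\<^sub>R grad \<phi> x) \<le> B * norm (u x)" for x
      using mult_left_mono[OF B(2), of "\<bar>u x\<bar>" x] by (simp add: mult.commute)
  qed (rule out(2))
qed

lemma sigma_finite_lebesgue: "sigma_finite_measure (lebesgue :: 'a::euclidean_space measure)"
proof
  let ?A = "range (\<lambda>n. cball 0 (real n) :: 'a set)"
  have "\<Union>?A = UNIV" by (auto intro: real_arch_simple)
  moreover have "emeasure lebesgue a \<noteq> \<infinity>" if "a \<in> ?A" for a
    using that emeasure_lborel_cball_finite by (auto simp: less_top)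
  ultimately show "\<exists>A::'a set set. countable A \<and> A \<subseteq> sets lebesgue \<and> \<Union>A = space lebesgue \<and>
      (\<forall>a\<in>A. emeasure lebesgue a \<noteq> \<infinity>)"
    by (intro exI[of _ ?A]) auto
qed

text \<open>The sets over which the integral vanishes form a Dynkin system; the open boxes generate the Borel
  sets and are closed under intersection, and Lebesgue measurable sets differ from Borel sets by
  null sets.\<close>
lemma integral_zero_on_boxes_imp_AE_zero:
  fixes f :: "'a::euclidean_space \<Rightarrow> 'b::euclidean_space"
  assumes f: "integrable lebesgue f"
    and box: "\<And>a b. (LINT x:box a b|lebesgue. f x) = 0" and total: "(LINT x|lebesgue. f x) = 0"
  shows "AE x in lebesgue. f x = 0"
proof (rule sigma_finite_measure.density_zero[OF sigma_finite_lebesgue f])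
  have si: "set_integrable lebesgue A f" if "A \<in> sets lebesgue" for A
    using f that by (simp add: set_integrable_def integrable_mult_indicator)
  have borel: "(LINT x:A|lebesgue. f x) = 0" if "A \<in> sets borel" for A
  proof -
    have "Int_stable (range (\<lambda>(a, b). box a b :: 'a set))"
      by (auto simp: Int_stable_def box_Int_box)
    moreover have "range (\<lambda>(a, b). box a b :: 'a set) \<subseteq> Pow UNIV" by simp
    moreover have "A \<in> sigma_sets UNIV (range (\<lambda>(a, b). box a b))"
      using that by (simp add: borel_eq_box)
    ultimately show ?thesis
    proof (induction rule: sigma_sets_induct_disjoint)
      case (compl A)
      then have "A \<in> sets borel" by (simp add: borel_eq_box)
      then have A: "A \<in> sets lebesgue" by (simp add: sets_completionI_sets)
      have "(LINT x:A \<union> (UNIV - A)|lebesgue. f x) = (LINT x:A|lebesgue. f x) + (LINT x:UNIV - A|lebesgue. f x)"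
        using A by (intro set_integral_Un si) auto
      moreover have "A \<union> (UNIV - A) = UNIV" by auto
      ultimately show ?case using compl total by (simp add: set_lebesgue_integral_def)
    next
      case (union A)
      then have "A i \<in> sets borel" for i by (auto simp: borel_eq_box)
      then have A: "A i \<in> sets lebesgue" for i by (simp add: sets_completionI_sets)
      then have "(LINT x:(\<Union>i. A i)|lebesgue. f x) = (\<Sum>i. (LINT x:(A i)|lebesgue. f x))"
        using union(1) by (intro lebesgue_integral_countable_add si) (auto simp: disjoint_family_on_def)
      then show ?case using union by simp
    qed (use box in \<open>auto simp: set_lebesgue_integral_def\<close>)
  qed
  fix A :: "'a set" assume A: "A \<in> sets lebesgue"
  then obtain S N N' where SN: "A = S \<union> N" "N \<subseteq> N'" "N' \<in> null_sets lborel" "S \<in> sets lborel"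
    by (rule sets_completionE)
  then have "N' \<in> null_sets lebesgue" by (simp add: null_sets_completionI)
  then have "AE x in lebesgue. x \<notin> N'" by (rule AE_not_in)
  then have N': "AE x in lebesgue. x \<notin> N'" .
  have "(LINT x:A|lebesgue. f x) = (LINT x:S|lebesgue. f x)"
    unfolding set_lebesgue_integral_def
  proof (rule integral_cong_AE)
    show "(\<lambda>x. indicator A x *\<^sub>R f x) \<in> borel_measurable lebesgue"
      "(\<lambda>x. indicator S x *\<^sub>R f x) \<in> borel_measurable lebesgue"
      using A SN(4)
      by (auto intro!: borel_measurable_integrable integrable_mult_indicator f simp del: integrable_mult_indicator
          simp: sets_completionI_sets)
    show "AE x in lebesgue. indicator A x *\<^sub>R f x = indicator S x *\<^sub>R f x"
      using N' by eventually_elim (use SN in \<open>auto simp: indicator_def\<close>)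
  qed
  also have "\<dots> = 0" using SN borel by simp
  finally show "(LINT x:A|lebesgue. f x) = 0" .
qed

text \<open>Testing with bumps that increase to the indicator of a box gives vanishing integrals over all boxes
  with closure in \<open>\<Omega>\<close>, so \<open>d\<close> vanishes almost everywhere on each of them, and countably many of these
  boxes cover \<open>\<Omega>\<close>.\<close>
lemma fundamental_lemma_variations:
  fixes d :: "'a::euclidean_space \<Rightarrow> 'b::euclidean_space"
  assumes "open \<Omega>" and d: "locally_integrable_on \<Omega> d"
    and zero: "\<And>\<phi>. \<phi> \<in> test_functions \<Omega> \<Longrightarrow> (LINT x|lebesgue_on \<Omega>. \<phi> x *\<^sub>R d x) = 0"
  shows "AE x in lebesgue_on \<Omega>. d x = 0"
proof -
  have box: "(LINT x|lebesgue. indicator (box a b) x *\<^sub>R d x) = 0"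
    and int: "integrable lebesgue (\<lambda>x. indicator (box a b) x *\<^sub>R d x)" if ab: "cbox a b \<subseteq> \<Omega>" for a b
  proof -
    have dK: "integrable lebesgue (\<lambda>x. indicator (cbox a b) x *\<^sub>R d x)"
    proof -
      have "integrable (lebesgue_on (cbox a b)) d"
        using d ab compact_cbox[of a b] by (auto simp: locally_integrable_on_def)
      then show ?thesis by (simp add: integrable_restrict_space)
    qed
    have eq: "indicator (box a b) x *\<^sub>R d x = indicator (box a b) x *\<^sub>R (indicator (cbox a b) x *\<^sub>R d x)"
      and eqn: "box_bump a b n x *\<^sub>R d x = box_bump a b n x *\<^sub>R (indicator (cbox a b) x *\<^sub>R d x)"
      and eq\<Omega>: "indicator \<Omega> x *\<^sub>R box_bump a b n x *\<^sub>R d x = box_bump a b n x *\<^sub>R d x" for n x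
      using box_subset_cbox[of a b] box_bump_outside[of x a b n] ab by (auto simp: indicator_def)
    show "integrable lebesgue (\<lambda>x. indicator (box a b) x *\<^sub>R d x)"
      by (subst eq) (rule integrable_mult_indicator[OF _ dK], simp)
    have "(\<lambda>n. LINT x|lebesgue. box_bump a b n x *\<^sub>R d x) \<longlonglongrightarrow> (LINT x|lebesgue. indicator (box a b) x *\<^sub>R d x)"
    proof (rule integral_dominated_convergence)
      show "integrable lebesgue (\<lambda>x. norm (indicator (cbox a b) x *\<^sub>R d x))" by (rule integrable_norm[OF dK])
      show "(\<lambda>x. indicator (box a b) x *\<^sub>R d x) \<in> borel_measurable lebesgue"
        by (rule borel_measurable_integrable) fact
      show "(\<lambda>x. box_bump a b n x *\<^sub>R d x) \<in> borel_measurable lebesgue" for n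
        using test_function_measurable(1)[OF box_bump_test_function[OF ab, of n], of UNIV]
        by (subst eqn, intro borel_measurable_scaleR borel_measurable_integrable[OF dK]) simp
      show "AE x in lebesgue. (\<lambda>n. box_bump a b n x *\<^sub>R d x) \<longlonglongrightarrow> indicator (box a b) x *\<^sub>R d x"
        by (intro AE_I2 tendsto_scaleR box_bump_tendsto tendsto_const)
      show "AE x in lebesgue. norm (box_bump a b n x *\<^sub>R d x) \<le> norm (indicator (cbox a b) x *\<^sub>R d x)" for n
      proof (rule AE_I2)
        fix x
        have "norm (box_bump a b n x *\<^sub>R v) \<le> norm v" for v :: 'b
          using box_bump_bounds[of a b n x] by (simp add: mult_left_le_one_le)
        then show "norm (box_bump a b n x *\<^sub>R d x) \<le> norm (indicator (cbox a b) x *\<^sub>R d x)"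
          by (subst eqn)
      qed
    qed
    moreover have "(LINT x|lebesgue. box_bump a b n x *\<^sub>R d x) = 0" for n
      using zero[OF box_bump_test_function[OF ab, of n]] \<open>open \<Omega>\<close>
      by (simp add: integral_restrict_space eq\<Omega> del: scaleR_scaleR)
    ultimately show "(LINT x|lebesgue. indicator (box a b) x *\<^sub>R d x) = 0"
      by (simp add: LIMSEQ_const_iff)
  qed
  have AE_box: "AE x in lebesgue. x \<in> cbox a b \<longrightarrow> d x = 0" if ab: "cbox a b \<subseteq> \<Omega>" for a b
  proof -
    have "AE x in lebesgue. indicator (box a b) x *\<^sub>R d x = 0"
    proof (rule integral_zero_on_boxes_imp_AE_zero[OF int[OF ab]])
      fix c e :: 'a
      obtain a' b' where ab': "box a b \<inter> box c e = box a' b'" using box_Int_box by blast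
      have "(LINT x|lebesgue. indicator (box a' b') x *\<^sub>R d x) = 0"
        \<comment> \<open>only a nonempty box determines its corners, and hence its closure\<close>
      proof (cases "box a' b' = {}")
        case False
        then have "cbox a' b' = closure (box a' b')" by simp
        also have "\<dots> \<subseteq> cbox a b"
          using ab' box_subset_cbox[of a b] by (intro closure_minimal) auto
        finally show ?thesis using ab by (intro box) auto
      qed simp
      moreover have "indicator (box c e) x *\<^sub>R indicator (box a b) x *\<^sub>R d x = indicator (box a' b') x *\<^sub>R d x" for x
        using ab' by (auto simp: indicator_def)
      ultimately show "(LINT x:box c e|lebesgue. indicator (box a b) x *\<^sub>R d x) = 0"
        by (simp only: set_lebesgue_integral_def)
    qed (rule box[OF ab])
    moreover have "AE x in lebesgue. x \<notin> cbox a b - box a b"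
      using negligible_frontier_interval[of a b] by (intro AE_not_in) (simp add: negligible_iff_null_sets)
    ultimately show ?thesis by eventually_elim (auto simp: indicator_def split: if_splits)
  qed
  obtain \<D> where D: "countable \<D>" "\<D> \<subseteq> Pow \<Omega>" "\<And>X. X \<in> \<D> \<Longrightarrow> \<exists>a b. X = cbox a b" "\<Union>\<D> = \<Omega>"
    using open_countable_Union_open_cbox[OF \<open>open \<Omega>\<close>] by metis
  have "AE x in lebesgue. \<forall>X\<in>\<D>. x \<in> X \<longrightarrow> d x = 0"
    unfolding AE_ball_countable[OF D(1)] using D(2,3) AE_box by (metis Pow_iff subsetD)
  then have "AE x in lebesgue. x \<in> \<Omega> \<longrightarrow> d x = 0"
    by eventually_elim (use D(4) in blast)
  then show ?thesis using \<open>open \<Omega>\<close> by (simp add: AE_restrict_space_iff)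
qed

text \<open>By translation invariance all difference quotients in a coordinate direction have integral \<open>0\<close>.
  They are bounded by the Lipschitz constant and live on a fixed ball, so the limit may be taken under
  the integral.\<close>
lemma integral_grad_test_zero:
  assumes \<phi>: "\<phi> \<in> test_functions \<Omega>"
  shows "(LINT x|lborel. grad \<phi> x) = 0"
proof -
  let ?K = "closure {x. \<phi> x \<noteq> 0}"
  have "compact ?K" using \<phi> by (auto simp: test_functions_def)
  then obtain R where R: "\<And>x. x \<in> ?K \<Longrightarrow> norm x \<le> R"
    using compact_imp_bounded bounded_iff by metis
  obtain B where B: "0 < B" "\<And>x. \<bar>\<phi> x\<bar> \<le> B" "\<And>x. norm (grad \<phi> x) \<le> B"
    using test_function_bounded[OF \<phi>] by metis
  have [measurable]: "\<phi> \<in> borel_measurable borel" "grad \<phi> \<in> borel_measurable borel"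
    using test_function_continuous[OF \<phi>] by (auto intro: borel_measurable_continuous_onI)
  have ball: "integrable lborel (\<lambda>x::'a. B * indicator (cball 0 r) x)" for r
    using emeasure_lborel_cball_finite[of "0::'a" r] by (auto simp: less_top)
  have int\<phi>: "integrable lborel \<phi>"
  proof (rule Bochner_Integration.integrable_bound[OF ball[of R]])
    show "AE x in lborel. norm (\<phi> x) \<le> norm (B * indicator (cball 0 R) x)"
    proof (rule AE_I2)
      fix x show "norm (\<phi> x) \<le> norm (B * indicator (cball 0 R) x)"
        using B(1) B(2)[of x] R[of x] test_function_outside[of x \<phi>]
        by (cases "x \<in> ?K") (auto simp: indicator_def)
    qed
  qed auto
  have intg: "integrable lborel (grad \<phi>)"
  proof (rule Bochner_Integration.integrable_bound[OF ball[of R]])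
    show "AE x in lborel. norm (grad \<phi> x) \<le> norm (B * indicator (cball 0 R) x)"
    proof (rule AE_I2)
      fix x show "norm (grad \<phi> x) \<le> norm (B * indicator (cball 0 R) x)"
        using B(1) B(3)[of x] R[of x] test_function_outside[of x \<phi>]
        by (cases "x \<in> ?K") (auto simp: indicator_def)
    qed
  qed auto
  have "(LINT x|lborel. grad \<phi> x) \<bullet> b = 0" if b: "b \<in> Basis" for b
  proof -
    define t :: "nat \<Rightarrow> real" where "t n = 1 / (real n + 1)" for n
    have t: "0 < t n" "t n \<le> 1" for n by (auto simp: t_def)
    have t0: "t \<longlonglongrightarrow> 0" unfolding t_def using LIMSEQ_inverse_real_of_nat
      by (simp add: inverse_eq_divide add.commute)
    have shift: "integrable lborel (\<lambda>x. \<phi> (c + x))" "(LINT x|lborel. \<phi> (c + x)) = (LINT x|lborel. \<phi> x)" for c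
    proof -
      have "integrable (distr lborel borel ((+) c)) \<phi>" using int\<phi> by (simp add: lborel_distr_plus)
      then show "integrable lborel (\<lambda>x. \<phi> (c + x))" by (simp add: integrable_distr_eq)
      have "(LINT x|lborel. \<phi> x) = (LINT x|distr lborel borel ((+) c). \<phi> x)" by (simp add: lborel_distr_plus)
      also have "\<dots> = (LINT x|lborel. \<phi> (c + x))" by (simp add: integral_distr)
      finally show "(LINT x|lborel. \<phi> (c + x)) = (LINT x|lborel. \<phi> x)" ..
    qed
    have "(\<lambda>n. LINT x|lborel. (\<phi> (t n *\<^sub>R b + x) - \<phi> x) / t n) \<longlonglongrightarrow> (LINT x|lborel. grad \<phi> x \<bullet> b)"
    proof (rule integral_dominated_convergence[OF _ _ ball[of "R + 1"]])
      show "AE x in lborel. (\<lambda>n. (\<phi> (t n *\<^sub>R b + x) - \<phi> x) / t n) \<longlonglongrightarrow> grad \<phi> x \<bullet> b"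
      proof (rule AE_I2)
        fix x
        have "((\<lambda>s. \<phi> (s *\<^sub>R b + x)) has_derivative (\<lambda>s. grad \<phi> x \<bullet> (s *\<^sub>R b))) (at 0)"
          by (rule has_derivative_compose[of _ _ 0 UNIV \<phi>, simplified])
             (use test_function_has_derivative[OF \<phi>] in \<open>auto intro!: derivative_eq_intros\<close>)
        then have "((\<lambda>s. \<phi> (s *\<^sub>R b + x)) has_real_derivative grad \<phi> x \<bullet> b) (at 0)"
          by (simp add: has_field_derivative_def mult.commute[of _ "grad \<phi> x \<bullet> b"])
        then have "((\<lambda>s. (\<phi> (s *\<^sub>R b + x) - \<phi> x) / s) \<longlongrightarrow> grad \<phi> x \<bullet> b) (at 0)"
          by (simp add: has_field_derivative_iff)
        moreover have "filterlim t (at 0) sequentially"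
          using t0 t(1) by (auto simp: filterlim_at less_imp_neq[symmetric] intro!: always_eventually)
        ultimately show "(\<lambda>n. (\<phi> (t n *\<^sub>R b + x) - \<phi> x) / t n) \<longlonglongrightarrow> grad \<phi> x \<bullet> b"
          by (rule filterlim_compose)
      qed
      show "AE x in lborel. norm ((\<phi> (t n *\<^sub>R b + x) - \<phi> x) / t n) \<le> B * indicator (cball 0 (R + 1)) x" for n
      proof (rule AE_I2)
        fix x
        have "\<bar>\<phi> (t n *\<^sub>R b + x) - \<phi> x\<bar> \<le> B * t n"
          using test_function_lipschitz[OF \<phi> B(3), of "t n *\<^sub>R b + x" x] b t(1)[of n] by simp
        then have le: "norm ((\<phi> (t n *\<^sub>R b + x) - \<phi> x) / t n) \<le> B"
          using t(1)[of n] by (simp add: field_simps)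
        show "norm ((\<phi> (t n *\<^sub>R b + x) - \<phi> x) / t n) \<le> B * indicator (cball 0 (R + 1)) x"
        proof (cases "norm x \<le> R + 1")
          case False
          \<comment> \<open>both points lie outside the ball of radius \<open>R\<close>, as \<open>t n \<le> 1\<close>\<close>
          have "norm x \<le> norm (t n *\<^sub>R b + x) + norm (t n *\<^sub>R b)"
            using norm_triangle_ineq4[of "t n *\<^sub>R b + x" "t n *\<^sub>R b"] by simp
          then have "norm (t n *\<^sub>R b + x) > R" using False b t[of n] by simp
          then have "t n *\<^sub>R b + x \<notin> ?K" "x \<notin> ?K" using R False by fastforce+
          then have "\<phi> (t n *\<^sub>R b + x) = 0" "\<phi> x = 0" using test_function_outside(1)[of _ \<phi>] by blast+
          then show ?thesis using B(1) by (simp add: indicator_def)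
        qed (use le in simp)
      qed
    qed auto
    moreover have z: "(LINT x|lborel. (\<phi> (t n *\<^sub>R b + x) - \<phi> x) / t n) = 0" for n
      using shift[of "t n *\<^sub>R b"] int\<phi> by simp
    ultimately have "(\<lambda>n. 0) \<longlonglongrightarrow> (LINT x|lborel. grad \<phi> x \<bullet> b)" by (simp only: z)
    then show ?thesis using intg by (simp add: LIMSEQ_const_iff)
  qed
  then show ?thesis by (simp add: euclidean_eq_iff[of _ "0::'a"])
qed

section \<open>Weak gradients and admissible variations\<close>

lemma continuous_locally_integrable:
  fixes f :: "'a::euclidean_space \<Rightarrow> 'b::euclidean_space"
  assumes "continuous_on UNIV f"
  shows "locally_integrable_on \<Omega> f"
  unfolding locally_integrable_on_def
proof (intro allI impI)
  fix K assume K: "compact K \<and> K \<subseteq> \<Omega>"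
  then have "integrable lborel (\<lambda>x. indicator K x *\<^sub>R f x)"
    using assms by (intro borel_integrable_compact) (auto intro: continuous_on_subset)
  moreover have "(\<lambda>x. indicator K x *\<^sub>R f x) \<in> borel_measurable borel"
    using K assms by (intro borel_measurable_continuous_on_indicator) (auto intro: continuous_on_subset borel_compact)
  ultimately show "integrable (lebesgue_on K) f"
    using K by (subst integrable_restrict_space) (simp_all add: borel_compact sets_completionI_sets integrable_completion)
qed

text \<open>Integration by parts for two test functions: the gradient of their product has integral \<open>0\<close>.\<close>
lemma has_weak_gradient_test_function:
  assumes \<Omega>: "open \<Omega>" and \<psi>: "\<psi> \<in> test_functions \<Omega>"
  shows "has_weak_gradient \<Omega> \<psi> (grad \<psi>)"
  unfolding has_weak_gradient_def
proof (intro conjI ballI)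
  show loc: "locally_integrable_on \<Omega> \<psi>" "locally_integrable_on \<Omega> (grad \<psi>)"
    using test_function_continuous[OF \<psi>] by (auto intro: continuous_locally_integrable)
  fix \<phi> assume \<phi>: "\<phi> \<in> test_functions \<Omega>"
  note int = integrable_mult_test(2)[OF \<Omega> \<phi> loc(1)] integrable_mult_test(1)[OF \<Omega> \<phi> loc(2)]
  have [simp]: "grad (\<lambda>x. \<psi> x * \<phi> x) x = \<psi> x *\<^sub>R grad \<phi> x + \<phi> x *\<^sub>R grad \<psi> x" for x
    by (rule grad_mult[OF \<psi> \<phi>])
  have out: "indicator \<Omega> x *\<^sub>R grad (\<lambda>x. \<psi> x * \<phi> x) x = grad (\<lambda>x. \<psi> x * \<phi> x) x" for x
    using test_function_outside_domain[OF test_functions_mult[OF \<psi> \<phi>], of x] by (auto simp: indicator_def)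
  have "(LINT x|lebesgue_on \<Omega>. grad (\<lambda>x. \<psi> x * \<phi> x) x) = (LINT x|lebesgue. grad (\<lambda>x. \<psi> x * \<phi> x) x)"
    using \<Omega> by (subst integral_restrict_space) (simp_all only: out, auto)
  also have "\<dots> = (LINT x|lborel. grad (\<lambda>x. \<psi> x * \<phi> x) x)"
    using test_function_continuous(2)[OF test_functions_mult[OF \<psi> \<phi>]]
    by (intro integral_completion) (simp add: borel_measurable_continuous_onI)
  also have "\<dots> = 0" by (rule integral_grad_test_zero[OF test_functions_mult[OF \<psi> \<phi>]])
  finally show "(LINT x|lebesgue_on \<Omega>. \<psi> x *\<^sub>R grad \<phi> x) = - (LINT x|lebesgue_on \<Omega>. \<phi> x *\<^sub>R grad \<psi> x)"
    using int by (simp add: add_eq_0_iff)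
qed

lemma locally_integrable_add:
  "locally_integrable_on \<Omega> f \<Longrightarrow> locally_integrable_on \<Omega> g \<Longrightarrow> locally_integrable_on \<Omega> (\<lambda>x. f x + c *\<^sub>R g x)"
  by (auto simp: locally_integrable_on_def)

lemma has_weak_gradient_add:
  assumes \<Omega>: "open \<Omega>" and u: "has_weak_gradient \<Omega> u w" and v: "has_weak_gradient \<Omega> v z"
  shows "has_weak_gradient \<Omega> (\<lambda>x. u x + c * v x) (\<lambda>x. w x + c *\<^sub>R z x)"
  unfolding has_weak_gradient_def
proof (intro conjI ballI)
  have loc: "locally_integrable_on \<Omega> u" "locally_integrable_on \<Omega> w"
     "locally_integrable_on \<Omega> v" "locally_integrable_on \<Omega> z"
    using u v by (auto simp: has_weak_gradient_def)
  show "locally_integrable_on \<Omega> (\<lambda>x. u x + c * v x)"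
    using locally_integrable_add[OF loc(1,3), of c] by simp
  show "locally_integrable_on \<Omega> (\<lambda>x. w x + c *\<^sub>R z x)"
    by (rule locally_integrable_add[OF loc(2,4)])
  fix \<phi> assume \<phi>: "\<phi> \<in> test_functions \<Omega>"
  have eq: "(LINT x|lebesgue_on \<Omega>. u x *\<^sub>R grad \<phi> x) = - (LINT x|lebesgue_on \<Omega>. \<phi> x *\<^sub>R w x)"
    "(LINT x|lebesgue_on \<Omega>. v x *\<^sub>R grad \<phi> x) = - (LINT x|lebesgue_on \<Omega>. \<phi> x *\<^sub>R z x)"
    using u v \<phi> by (auto simp: has_weak_gradient_def)
  note int = integrable_mult_test(2)[OF \<Omega> \<phi> loc(1)] integrable_mult_test(2)[OF \<Omega> \<phi> loc(3)]
    integrable_mult_test(1)[OF \<Omega> \<phi> loc(2)] integrable_mult_test(1)[OF \<Omega> \<phi> loc(4)]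
  have "(LINT x|lebesgue_on \<Omega>. (u x + c * v x) *\<^sub>R grad \<phi> x)
      = (LINT x|lebesgue_on \<Omega>. u x *\<^sub>R grad \<phi> x + c *\<^sub>R (v x *\<^sub>R grad \<phi> x))"
    by (simp add: scaleR_add_left)
  also have "\<dots> = (LINT x|lebesgue_on \<Omega>. u x *\<^sub>R grad \<phi> x) + c *\<^sub>R (LINT x|lebesgue_on \<Omega>. v x *\<^sub>R grad \<phi> x)"
    using int by (subst Bochner_Integration.integral_add) (simp_all del: scaleR_scaleR)
  also have "\<dots> = - ((LINT x|lebesgue_on \<Omega>. \<phi> x *\<^sub>R w x) + c *\<^sub>R (LINT x|lebesgue_on \<Omega>. \<phi> x *\<^sub>R z x))"
    by (simp add: eq)
  also have "(LINT x|lebesgue_on \<Omega>. \<phi> x *\<^sub>R w x) + c *\<^sub>R (LINT x|lebesgue_on \<Omega>. \<phi> x *\<^sub>R z x)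
      = (LINT x|lebesgue_on \<Omega>. \<phi> x *\<^sub>R w x + c *\<^sub>R (\<phi> x *\<^sub>R z x))"
    using int by (subst Bochner_Integration.integral_add) (simp_all del: scaleR_scaleR)
  finally show "(LINT x|lebesgue_on \<Omega>. (u x + c * v x) *\<^sub>R grad \<phi> x)
      = - (LINT x|lebesgue_on \<Omega>. \<phi> x *\<^sub>R (w x + c *\<^sub>R z x))"
    by (simp add: scaleR_add_right mult.commute)
qed

lemma weak_gradient_unique:
  assumes \<Omega>: "open \<Omega>" and w: "has_weak_gradient \<Omega> u w" and z: "has_weak_gradient \<Omega> u z"
  shows "AE x in lebesgue_on \<Omega>. w x = z x"
proof -
  have d: "has_weak_gradient \<Omega> (\<lambda>x. u x + - 1 * u x) (\<lambda>x. w x + - 1 *\<^sub>R z x)"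
    by (rule has_weak_gradient_add[OF \<Omega> w z])
  have "AE x in lebesgue_on \<Omega>. w x + - 1 *\<^sub>R z x = 0"
    by (rule fundamental_lemma_variations[OF \<Omega>])
       (use d in \<open>simp_all add: has_weak_gradient_def\<close>)
  then show ?thesis by eventually_elim simp
qed

lemma has_weak_gradient_subdomain:
  assumes "open U" "open \<Omega>" "U \<subseteq> \<Omega>" and u: "has_weak_gradient \<Omega> u w"
  shows "has_weak_gradient U u w"
  unfolding has_weak_gradient_def
proof (intro conjI ballI)
  show "locally_integrable_on U u" "locally_integrable_on U w"
    using u assms(3) by (auto simp: has_weak_gradient_def locally_integrable_on_def)
  fix \<phi> assume \<phi>: "\<phi> \<in> test_functions U"
  have eq: "(LINT x|lebesgue_on U. u x *\<^sub>R grad \<phi> x) = (LINT x|lebesgue_on \<Omega>. u x *\<^sub>R grad \<phi> x)"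
    "(LINT x|lebesgue_on U. \<phi> x *\<^sub>R w x) = (LINT x|lebesgue_on \<Omega>. \<phi> x *\<^sub>R w x)"
    using assms test_function_outside_domain[OF \<phi>]
    by (auto intro!: integrable_lebesgue_on_superset(2) simp: sets_completionI_sets)
  show "(LINT x|lebesgue_on U. u x *\<^sub>R grad \<phi> x) = - (LINT x|lebesgue_on U. \<phi> x *\<^sub>R w x)"
    unfolding eq using u test_functions_mono[OF assms(3) \<phi>] by (simp add: has_weak_gradient_def)
qed

text \<open>Locality: on \<open>U\<close> the zero field also satisfies the identity defining the weak gradient of \<open>u\<close>, so the
  fundamental lemma applies to \<open>w\<close> itself.\<close>
lemma weak_gradient_zero:
  assumes "open U" "open \<Omega>" "U \<subseteq> \<Omega>" and u: "has_weak_gradient \<Omega> u w"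
    and zero: "AE x in lebesgue_on U. u x = 0"
  shows "AE x in lebesgue_on U. w x = 0"
proof (rule fundamental_lemma_variations[OF assms(1)])
  have w: "has_weak_gradient U u w" by (rule has_weak_gradient_subdomain[OF assms(1-4)])
  then show "locally_integrable_on U w" by (simp add: has_weak_gradient_def)
  fix \<phi> assume \<phi>: "\<phi> \<in> test_functions U"
  have "(LINT x|lebesgue_on U. u x *\<^sub>R grad \<phi> x) = 0"
    by (rule integral_eq_zero_AE) (use zero in \<open>auto elim: eventually_mono\<close>)
  then show "(LINT x|lebesgue_on U. \<phi> x *\<^sub>R w x) = 0"
    using w \<phi> by (simp add: has_weak_gradient_def)
qed

lemma Lp_add:
  fixes f g :: "'a::euclidean_space \<Rightarrow> 'b::euclidean_space"
  assumes p: "0 \<le> p" and f: "f \<in> Lp \<Omega> p" and g: "g \<in> Lp \<Omega> p"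
  shows "(\<lambda>x. f x + g x) \<in> Lp \<Omega> p"
proof -
  have [measurable]: "f \<in> borel_measurable (lebesgue_on \<Omega>)" "g \<in> borel_measurable (lebesgue_on \<Omega>)"
    and int: "integrable (lebesgue_on \<Omega>) (\<lambda>x. norm (f x) powr p)" "integrable (lebesgue_on \<Omega>) (\<lambda>x. norm (g x) powr p)"
    using f g by (auto simp: Lp_def)
  have "integrable (lebesgue_on \<Omega>) (\<lambda>x. norm (f x + g x) powr p)"
  proof (rule Bochner_Integration.integrable_bound)
    show "integrable (lebesgue_on \<Omega>) (\<lambda>x. 2 powr p * (norm (f x) powr p + norm (g x) powr p))"
      using int by auto
    show "AE x in lebesgue_on \<Omega>. norm (norm (f x + g x) powr p)
        \<le> norm (2 powr p * (norm (f x) powr p + norm (g x) powr p))"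
    proof (rule AE_I2)
      fix x
      have "norm (f x + g x) \<le> 2 * max (norm (f x)) (norm (g x))"
        using norm_triangle_ineq[of "f x" "g x"] by linarith
      then have "norm (f x + g x) powr p \<le> (2 * max (norm (f x)) (norm (g x))) powr p"
        using p by (intro powr_mono2) auto
      also have "\<dots> = 2 powr p * max (norm (f x)) (norm (g x)) powr p"
        by (simp add: powr_mult)
      also have "max (norm (f x)) (norm (g x)) powr p \<le> norm (f x) powr p + norm (g x) powr p"
        by (auto simp: max_def)
      finally show "norm (norm (f x + g x) powr p) \<le> norm (2 powr p * (norm (f x) powr p + norm (g x) powr p))"
        by (simp add: mult_left_mono)
    qed
  qed auto
  then show ?thesis by (auto simp: Lp_def)
qed

lemma finite_measure_lebesgue_on_bounded:
  assumes "open \<Omega>" "bounded (\<Omega> :: 'a::euclidean_space set)"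
  shows "finite_measure (lebesgue_on \<Omega>)"
proof
  have "\<Omega> \<in> lmeasurable" using assms by (simp add: lmeasurable_open)
  then show "emeasure (lebesgue_on \<Omega>) (space (lebesgue_on \<Omega>)) \<noteq> \<infinity>"
    by (simp add: emeasure_restrict_space fmeasurable_def less_top del: emeasure_completion)
qed

lemma bounded_in_Lp:
  fixes f :: "'a::euclidean_space \<Rightarrow> 'b::euclidean_space"
  assumes "open \<Omega>" "bounded \<Omega>" "0 \<le> p" "f \<in> borel_measurable (lebesgue_on \<Omega>)" "\<And>x. norm (f x) \<le> B"
  shows "f \<in> Lp \<Omega> p"
proof -
  interpret finite_measure "lebesgue_on \<Omega>" by (rule finite_measure_lebesgue_on_bounded[OF assms(1,2)])
  have "integrable (lebesgue_on \<Omega>) (\<lambda>x. norm (f x) powr p)"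
    using assms by (intro integrable_const_bound[where B="B powr p"]) (auto intro!: powr_mono2)
  then show ?thesis using assms by (simp add: Lp_def)
qed

text \<open>Completeness of Lebesgue measure. It makes measurable what is only known to agree almost everywhere with
  a measurable function, such as the chosen weak gradient of a competitor and its energy density.\<close>
lemma borel_measurable_lebesgue_on_AE:
  fixes f g :: "'a::euclidean_space \<Rightarrow> 'b::euclidean_space"
  assumes "open \<Omega>" "f \<in> borel_measurable (lebesgue_on \<Omega>)" "AE x in lebesgue_on \<Omega>. f x = g x"
  shows "g \<in> borel_measurable (lebesgue_on \<Omega>)"
proof -
  have \<Omega>: "\<Omega> \<inter> space lebesgue \<in> sets lebesgue" using assms(1) by simp
  have "(\<lambda>x. indicator \<Omega> x *\<^sub>R g x) \<in> borel_measurable lebesgue"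
  proof (rule borel_measurable_AE)
    show "(\<lambda>x. indicator \<Omega> x *\<^sub>R f x) \<in> borel_measurable lebesgue"
      using assms(2) \<Omega> by (simp add: borel_measurable_restrict_space_iff)
    have "AE x in lebesgue. x \<in> \<Omega> \<longrightarrow> f x = g x"
      using assms(3) \<Omega> by (simp add: AE_restrict_space_iff)
    then show "AE x in lebesgue. indicator \<Omega> x *\<^sub>R f x = indicator \<Omega> x *\<^sub>R g x"
      by eventually_elim (auto simp: indicator_def)
  qed
  then show ?thesis using \<Omega> by (simp add: borel_measurable_restrict_space_iff)
qed

lemma Lp_AE_cong:
  fixes f g :: "'a::euclidean_space \<Rightarrow> 'b::euclidean_space"
  assumes "open \<Omega>" "f \<in> Lp \<Omega> p" "AE x in lebesgue_on \<Omega>. f x = g x"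
  shows "g \<in> Lp \<Omega> p"
proof -
  have f[measurable]: "f \<in> borel_measurable (lebesgue_on \<Omega>)" and int: "integrable (lebesgue_on \<Omega>) (\<lambda>x. norm (f x) powr p)"
    using assms(2) by (auto simp: Lp_def)
  have g[measurable]: "g \<in> borel_measurable (lebesgue_on \<Omega>)"
    by (rule borel_measurable_lebesgue_on_AE[OF assms(1) f assms(3)])
  have "integrable (lebesgue_on \<Omega>) (\<lambda>x. norm (g x) powr p) \<longleftrightarrow> integrable (lebesgue_on \<Omega>) (\<lambda>x. norm (f x) powr p)"
    by (intro integrable_cong_AE) (use assms(3) in \<open>auto elim: eventually_mono\<close>)
  then show ?thesis using int g by (simp add: Lp_def)
qed

text \<open>The choice of a weak gradient is made among all of them and not only among those in \<open>L\<^sup>p\<close>; uniqueness shows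
  that the chosen one lies in \<open>L\<^sup>p\<close> nevertheless.\<close>
lemma W1p_weak_grad:
  assumes "open \<Omega>" "u \<in> W1p \<Omega> p"
  shows "has_weak_gradient \<Omega> u (weak_grad \<Omega> u)" "weak_grad \<Omega> u \<in> Lp \<Omega> p"
proof -
  obtain w where w: "w \<in> Lp \<Omega> p" "has_weak_gradient \<Omega> u w" using assms by (auto simp: W1p_def)
  from someI[of "has_weak_gradient \<Omega> u", OF w(2)]
  show W: "has_weak_gradient \<Omega> u (weak_grad \<Omega> u)" by (simp add: weak_grad_def)
  show "weak_grad \<Omega> u \<in> Lp \<Omega> p"
    by (rule Lp_AE_cong[OF assms(1) w(1) weak_gradient_unique[OF assms(1) w(2) W]])
qed

lemma weak_grad_AE_eq:
  assumes "open \<Omega>" "has_weak_gradient \<Omega> u w"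
  shows "AE x in lebesgue_on \<Omega>. weak_grad \<Omega> u x = w x"
  using someI[of "has_weak_gradient \<Omega> u", OF assms(2)]
  by (intro weak_gradient_unique[OF assms(1) _ assms(2)]) (simp add: weak_grad_def)

lemma W1p_add_test:
  assumes \<Omega>: "open \<Omega>" "bounded \<Omega>" and p: "0 \<le> p" and u: "u \<in> W1p \<Omega> p" and \<phi>: "\<phi> \<in> test_functions \<Omega>"
  shows "(\<lambda>x. u x + c * \<phi> x) \<in> W1p \<Omega> p"
    and "AE x in lebesgue_on \<Omega>. weak_grad \<Omega> (\<lambda>x. u x + c * \<phi> x) x = weak_grad \<Omega> u x + c *\<^sub>R grad \<phi> x"
proof -
  obtain B where B: "\<And>x. \<bar>\<phi> x\<bar> \<le> B" "\<And>x. norm (grad \<phi> x) \<le> B"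
    using test_function_bounded[OF \<phi>] by metis
  have [measurable]: "\<phi> \<in> borel_measurable (lebesgue_on \<Omega>)" "grad \<phi> \<in> borel_measurable (lebesgue_on \<Omega>)"
    using test_function_measurable[OF \<phi>] by auto
  have "(\<lambda>x. c * \<phi> x) \<in> Lp \<Omega> p"
    by (rule bounded_in_Lp[OF \<Omega> p, where B="\<bar>c\<bar> * B"]) (auto simp: abs_mult B mult_left_mono)
  then have 1: "(\<lambda>x. u x + c * \<phi> x) \<in> Lp \<Omega> p" using u by (intro Lp_add p) (auto simp: W1p_def)
  have "(\<lambda>x. c *\<^sub>R grad \<phi> x) \<in> Lp \<Omega> p"
    by (rule bounded_in_Lp[OF \<Omega> p, where B="\<bar>c\<bar> * B"]) (auto simp: B mult_left_mono)
  then have 2: "(\<lambda>x. weak_grad \<Omega> u x + c *\<^sub>R grad \<phi> x) \<in> Lp \<Omega> p"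
    using W1p_weak_grad(2)[OF \<Omega>(1) u] by (intro Lp_add p)
  have 3: "has_weak_gradient \<Omega> (\<lambda>x. u x + c * \<phi> x) (\<lambda>x. weak_grad \<Omega> u x + c *\<^sub>R grad \<phi> x)"
    by (rule has_weak_gradient_add[OF \<Omega>(1) W1p_weak_grad(1)[OF \<Omega>(1) u] has_weak_gradient_test_function[OF \<Omega>(1) \<phi>]])
  show "(\<lambda>x. u x + c * \<phi> x) \<in> W1p \<Omega> p" using 1 2 3 by (auto simp: W1p_def)
  show "AE x in lebesgue_on \<Omega>. weak_grad \<Omega> (\<lambda>x. u x + c * \<phi> x) x = weak_grad \<Omega> u x + c *\<^sub>R grad \<phi> x"
    by (rule weak_grad_AE_eq[OF \<Omega>(1) 3])
qed

lemma W1p_0_add_test: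
  assumes \<Omega>: "open \<Omega>" "bounded \<Omega>" and p: "0 \<le> p" and u: "u \<in> W1p_0 \<Omega> p" and \<phi>: "\<phi> \<in> test_functions \<Omega>"
  shows "(\<lambda>x. u x + c * \<phi> x) \<in> W1p_0 \<Omega> p"
proof -
  obtain f where uW: "u \<in> W1p \<Omega> p" and f: "\<And>n. f n \<in> test_functions \<Omega>"
    and lim: "(\<lambda>n. LINT x|lebesgue_on \<Omega>. \<bar>u x - f n x\<bar> powr p) \<longlonglongrightarrow> 0"
      "(\<lambda>n. LINT x|lebesgue_on \<Omega>. norm (weak_grad \<Omega> u x - grad (f n) x) powr p) \<longlonglongrightarrow> 0"
    using u by (auto simp: W1p_0_def)
  note W = W1p_add_test[OF \<Omega> p uW \<phi>, of c]
  have c\<phi>: "(\<lambda>x. c * \<phi> x) \<in> test_functions \<Omega>" by (rule test_functions_cmult[OF \<phi>])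
  have [measurable]: "weak_grad \<Omega> u \<in> borel_measurable (lebesgue_on \<Omega>)"
    "weak_grad \<Omega> (\<lambda>x. u x + c * \<phi> x) \<in> borel_measurable (lebesgue_on \<Omega>)"
    using W1p_weak_grad(2)[OF \<Omega>(1) uW] W1p_weak_grad(2)[OF \<Omega>(1) W(1)] by (auto simp: Lp_def)
  have g: "grad (\<lambda>x. f n x + c * \<phi> x) x = grad (f n) x + c *\<^sub>R grad \<phi> x" for n x
    using grad_add[OF f c\<phi>] grad_cmult[OF \<phi>] by simp
  have "(LINT x|lebesgue_on \<Omega>. norm (weak_grad \<Omega> (\<lambda>x. u x + c * \<phi> x) x - grad (\<lambda>x. f n x + c * \<phi> x) x) powr p)
      = (LINT x|lebesgue_on \<Omega>. norm (weak_grad \<Omega> u x - grad (f n) x) powr p)" for n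
  proof (rule integral_cong_AE)
    note [measurable] = test_function_measurable[OF f[of n]] test_function_measurable[OF test_functions_add[OF f[of n] c\<phi>]]
    show "(\<lambda>x. norm (weak_grad \<Omega> (\<lambda>x. u x + c * \<phi> x) x - grad (\<lambda>x. f n x + c * \<phi> x) x) powr p) \<in> borel_measurable (lebesgue_on \<Omega>)"
      by measurable
    show "(\<lambda>x. norm (weak_grad \<Omega> u x - grad (f n) x) powr p) \<in> borel_measurable (lebesgue_on \<Omega>)"
      by measurable
    show "AE x in lebesgue_on \<Omega>. norm (weak_grad \<Omega> (\<lambda>x. u x + c * \<phi> x) x - grad (\<lambda>x. f n x + c * \<phi> x) x) powr p
        = norm (weak_grad \<Omega> u x - grad (f n) x) powr p"
      using W(2) by eventually_elim (simp add: g)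
  qed
  then show ?thesis
    unfolding W1p_0_def using W(1) lim test_functions_add[OF f c\<phi>]
    by (auto intro!: exI[of _ "\<lambda>n x. f n x + c * \<phi> x"])
qed

text \<open>Compactly supported perturbations do not change the boundary values: adding \<open>c \<phi>\<close> to every term of an
  approximating sequence of test functions leaves the approximation errors unchanged.\<close>
lemma K_class_add_test:
  assumes \<Omega>: "open \<Omega>" "bounded \<Omega>" and p: "0 \<le> p" and u: "u \<in> K_class \<Omega> p g" and \<phi>: "\<phi> \<in> test_functions \<Omega>"
  shows "(\<lambda>x. u x + c * \<phi> x) \<in> K_class \<Omega> p g"
proof -
  obtain w where uW: "u \<in> W1p \<Omega> p" and w: "w \<in> W1p \<Omega> p" "continuous_on (closure \<Omega>) w" "\<forall>x\<in>frontier \<Omega>. w x = g x"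
    and uw: "(\<lambda>x. u x - w x) \<in> W1p_0 \<Omega> p"
    using u by (auto simp: K_class_def)
  have "(\<lambda>x. (u x - w x) + c * \<phi> x) \<in> W1p_0 \<Omega> p" by (rule W1p_0_add_test[OF \<Omega> p uw \<phi>])
  moreover have "(\<lambda>x. (u x - w x) + c * \<phi> x) = (\<lambda>x. (u x + c * \<phi> x) - w x)" by auto
  ultimately show ?thesis
    using w W1p_add_test(1)[OF \<Omega> p uW \<phi>] by (auto simp: K_class_def)
qed

section \<open>Pointwise calculus of the energy density\<close>

text \<open>For \<open>q = 0\<close> and \<open>s < 0\<close> the right-hand side is \<open>0\<close> because of the convention \<open>0 powr 0 = 0\<close>.\<close>
lemma max_powr_has_derivative:
  assumes "s \<noteq> 0"
  shows "((\<lambda>s. max s 0 powr (q + 1)) has_real_derivative (q + 1) * max s 0 powr q) (at s)"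
proof (cases "0 < s")
  case True
  have "((\<lambda>s. s powr (q + 1)) has_real_derivative (q + 1) * max s 0 powr q) (at s)"
    using has_real_derivative_powr[OF True, of "q + 1"] True by simp
  then show ?thesis
    by (rule has_field_derivative_transform_within_open[where S="{0<..}"]) (use True in auto)
next
  case False
  have "((\<lambda>s. 0) has_real_derivative (q + 1) * max s 0 powr q) (at s)"
    using False assms by simp
  then show ?thesis
    by (rule has_field_derivative_transform_within_open[where S="{..<0}"]) (use False assms in auto)
qed

lemma max_powr_continuous:
  assumes "0 \<le> (q::real)"
  shows "continuous_on S (\<lambda>s. max s 0 powr (q + 1))"
  using assms by (intro continuous_on_powr' continuous_intros) auto

text \<open>Mean value theorem on the positive half-line; elsewhere \<open>s \<mapsto> max s 0\<close> is a contraction.\<close>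
lemma max_powr_diff_le:
  assumes q: "0 \<le> (q::real)"
  shows "\<bar>max b 0 powr (q + 1) - max a 0 powr (q + 1)\<bar> \<le> (q + 1) * (\<bar>a\<bar> + \<bar>b\<bar>) powr q * \<bar>b - a\<bar>"
proof -
  have main: "\<bar>max b 0 powr (q + 1) - max a 0 powr (q + 1)\<bar> \<le> (q + 1) * (\<bar>a\<bar> + \<bar>b\<bar>) powr q * \<bar>b - a\<bar>"
    if ab: "a < b" "0 \<le> a" for a b :: real
  proof -
    obtain z where z: "a < z" "z < b" "max b 0 powr (q + 1) - max a 0 powr (q + 1) = (q + 1) * max z 0 powr q * (b - a)"
    proof (rule mvt[OF ab(1), of "\<lambda>s. max s 0 powr (q + 1)" "\<lambda>s h. (q + 1) * max s 0 powr q * h"])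
      show "((\<lambda>s. max s 0 powr (q + 1)) has_derivative (*) ((q + 1) * max x 0 powr q)) (at x)" if "a < x" for x
        using max_powr_has_derivative[of x q] that ab by (simp add: has_field_derivative_def)
    qed (use max_powr_continuous[OF q] in auto)
    have "max z 0 powr q \<le> (\<bar>a\<bar> + \<bar>b\<bar>) powr q"
      using z that q by (intro powr_mono2) auto
    then have "(q + 1) * max z 0 powr q * (b - a) \<le> (q + 1) * (\<bar>a\<bar> + \<bar>b\<bar>) powr q * \<bar>b - a\<bar>"
      using that q by (intro mult_mono mult_left_mono) auto
    moreover have "0 \<le> (q + 1) * max z 0 powr q * (b - a)" using that q by simp
    ultimately show ?thesis using z(3) by simp
  qed
  have nonneg: "\<bar>max b 0 powr (q + 1) - max a 0 powr (q + 1)\<bar> \<le> (q + 1) * (\<bar>a\<bar> + \<bar>b\<bar>) powr q * \<bar>b - a\<bar>"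
    if "0 \<le> a" "0 \<le> b" for a b :: real
    using main[of a b] main[of b a] that
    by (cases a b rule: linorder_cases) (simp_all add: abs_minus_commute add.commute)
  have "\<bar>max b 0 powr (q + 1) - max a 0 powr (q + 1)\<bar>
      \<le> (q + 1) * (\<bar>max a 0\<bar> + \<bar>max b 0\<bar>) powr q * \<bar>max b 0 - max a 0\<bar>"
    using nonneg[of "max a 0" "max b 0"] by simp
  also have "\<dots> \<le> (q + 1) * (\<bar>a\<bar> + \<bar>b\<bar>) powr q * \<bar>b - a\<bar>"
    using q by (intro mult_mono mult_left_mono powr_mono2) auto
  finally show ?thesis .
qed

text \<open>The origin of the dichotomy between \<open>q = 0\<close> and \<open>q > 0\<close>: at \<open>s = 0\<close> the quotient equals
  \<open>t powr q * max v 0 powr (q + 1)\<close>, which tends to \<open>0\<close> exactly when \<open>q > 0\<close> or \<open>v \<le> 0\<close>.\<close>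
lemma max_powr_directional_derivative:
  assumes q: "0 \<le> (q::real)" and s: "0 \<le> s" and t: "\<And>n. 0 < t n" "t \<longlonglongrightarrow> 0"
  shows "(\<lambda>n. (max (s + t n * v) 0 powr (q + 1) - max s 0 powr (q + 1)) / t n) \<longlonglongrightarrow>
     (q + 1) * s powr q * v + (if q = 0 \<and> s = 0 then max v 0 else 0)"
proof (cases "s = 0")
  case False
  have "((\<lambda>s. max s 0 powr (q + 1)) has_real_derivative (q + 1) * max s 0 powr q) (at (s + 0 * v))"
    using max_powr_has_derivative[OF False] by simp
  then have "((\<lambda>\<tau>. max (s + \<tau> * v) 0 powr (q + 1)) has_real_derivative (q + 1) * max s 0 powr q * v) (at 0)"
    by (rule DERIV_chain2) (auto intro!: derivative_eq_intros)
  then have "((\<lambda>\<tau>. (max (s + \<tau> * v) 0 powr (q + 1) - max s 0 powr (q + 1)) / \<tau>) \<longlongrightarrow> (q + 1) * max s 0 powr q * v) (at 0)"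
    by (simp add: has_field_derivative_iff)
  moreover have "filterlim t (at 0) sequentially"
    using t by (auto simp: filterlim_at less_imp_neq[symmetric] intro!: always_eventually)
  ultimately show ?thesis using False s filterlim_compose by (fastforce simp: max_def)
next
  case True
  have eq: "(max (s + t n * v) 0 powr (q + 1) - max s 0 powr (q + 1)) / t n = t n powr q * max v 0 powr (q + 1)" for n
  proof -
    have "max (t n * v) 0 = t n * max v 0"
      using t(1)[of n] by (auto simp: max_def zero_le_mult_iff mult_le_0_iff)
    then show ?thesis using True t(1)[of n] q by (simp add: powr_mult powr_add)
  qed
  show ?thesis
  proof (cases "q = 0")
    case q0: True
    have eq2: "t n powr q * max v 0 powr (q + 1) = max v 0" for n
      using q0 t(1)[of n] by simp
    then show ?thesis unfolding eq eq2 using True q0 by simp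
  next
    case False
    then have "(\<lambda>n. t n powr q) \<longlonglongrightarrow> 0 powr q"
      using q t by (intro tendsto_powr' tendsto_const) (auto intro!: always_eventually simp: less_imp_le)
    then have "(\<lambda>n. t n powr q * max v 0 powr (q + 1)) \<longlonglongrightarrow> 0 powr q * max v 0 powr (q + 1)"
      by (intro tendsto_mult tendsto_const)
    then show ?thesis unfolding eq using True False by simp
  qed
qed

text \<open>Determines \<open>h x\<close> up to its value at \<open>0\<close>. That value may depend on \<open>x\<close> without any regularity, but it cancels
  in the difference of the energies of two competitors.\<close>
lemma max_powr_antiderivative:
  fixes f :: "real \<Rightarrow> real"
  assumes q: "0 \<le> q" and cont: "continuous_on UNIV f"
    and der: "\<And>s. s \<noteq> 0 \<Longrightarrow> (f has_real_derivative (q + 1) * c * max s 0 powr q) (at s)"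
  shows "f s = f 0 + c * max s 0 powr (q + 1)"
proof -
  let ?k = "\<lambda>s. f s - c * max s 0 powr (q + 1)"
  have k: "continuous_on S ?k" for S
    using cont by (intro continuous_intros max_powr_continuous q continuous_on_subset[OF cont]) auto
  have d: "(?k has_real_derivative 0) (at s)" if "s \<noteq> 0" for s
    using DERIV_diff[OF der[OF that] DERIV_cmult[OF max_powr_has_derivative[OF that, of q], of c]] by simp
  consider "s = 0" | "s < 0" | "0 < s" by linarith
  then have "?k s = ?k 0"
  proof cases
    case 2
    show ?thesis by (rule DERIV_isconst_end[OF 2 k, symmetric]) (use d in auto)
  next
    case 3
    show ?thesis by (rule DERIV_isconst_end[OF 3 k]) (use d in auto)
  qed simp
  then show ?thesis by simp
qed

lemma powr_growth_increment:
  fixes f :: "'a::euclidean_space \<Rightarrow> real"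
  assumes grad: "\<And>\<xi>. GDERIV f \<xi> :> F \<xi>" and F: "\<And>\<xi>. norm (F \<xi>) \<le> c * norm \<xi> powr r"
    and c: "0 \<le> c" and r: "0 \<le> r" and R: "norm \<xi> \<le> R" "norm \<eta> \<le> R"
  shows "\<bar>f \<eta> - f \<xi>\<bar> \<le> c * R powr r * norm (\<eta> - \<xi>)"
proof -
  have "norm (f \<eta> - f \<xi>) \<le> c * R powr r * norm (\<eta> - \<xi>)"
  proof (rule differentiable_bound[of "cball 0 R" f "\<lambda>x h. h \<bullet> F x"])
    fix x :: 'a assume x: "x \<in> cball 0 R"
    show "(f has_derivative (\<lambda>h. h \<bullet> F x)) (at x within cball 0 R)"
      using grad[of x] unfolding gderiv_def by (rule has_derivative_at_withinI)
    have "norm (F x) \<le> c * R powr r"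
      using F[of x] x c r by (intro order_trans[OF F] mult_left_mono powr_mono2) auto
    then show "onorm (\<lambda>h. h \<bullet> F x) \<le> c * R powr r"
    proof (intro onorm_bound)
      show "norm (h \<bullet> F x) \<le> c * R powr r * norm h" if "norm (F x) \<le> c * R powr r" for h
        using Cauchy_Schwarz_ineq2[of h "F x"] mult_left_mono[OF that, of "norm h"] by (simp add: mult.commute)
    qed (use c in auto)
  qed (use R in auto)
  then show ?thesis by simp
qed

text \<open>The gradient bound is uniform in \<open>x\<close>, so \<open>G x\<close> is locally Lipschitz uniformly in \<open>x\<close>; together with continuity
  in \<open>x\<close> this gives joint continuity, and with it measurability of \<open>x \<mapsto> G x (w x)\<close>.\<close>
lemma continuous_on_joint_of_growth:
  fixes G :: "'a::euclidean_space \<Rightarrow> 'a \<Rightarrow> real"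
  assumes cont: "\<And>\<xi>. continuous_on \<Omega> (\<lambda>x. G x \<xi>)"
    and grad: "\<And>x \<xi>. x \<in> \<Omega> \<Longrightarrow> GDERIV (G x) \<xi> :> \<Phi> x \<xi>"
    and \<Phi>: "\<And>x \<xi>. x \<in> \<Omega> \<Longrightarrow> norm (\<Phi> x \<xi>) \<le> c * norm \<xi> powr r" and c: "0 \<le> c" and r: "0 \<le> r"
  shows "continuous_on (\<Omega> \<times> UNIV) (\<lambda>(x, \<xi>). G x \<xi>)"
  unfolding continuous_on_def
proof
  fix z0 assume z0: "z0 \<in> \<Omega> \<times> (UNIV :: 'a set)"
  define x0 \<xi>0 where "x0 = fst z0" and "\<xi>0 = snd z0"
  let ?F = "at z0 within \<Omega> \<times> UNIV"
  let ?R = "norm \<xi>0 + 1"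
  have lim: "(fst \<longlongrightarrow> x0) ?F" "(snd \<longlongrightarrow> \<xi>0) ?F"
    by (auto simp: x0_def \<xi>0_def intro!: tendsto_intros)
  have ev\<Omega>: "eventually (\<lambda>z. fst z \<in> \<Omega>) ?F"
    by (auto simp: eventually_at_filter intro!: always_eventually)
  have c1: "((\<lambda>z. G (fst z) \<xi>0) \<longlongrightarrow> G x0 \<xi>0) ?F"
  proof -
    have "continuous_on (\<Omega> \<times> UNIV) (\<lambda>z :: 'a \<times> 'a. G (fst z) \<xi>0)"
      by (rule continuous_on_compose2[OF cont[of \<xi>0]]) (auto intro: continuous_intros)
    then show ?thesis using z0 by (auto simp: continuous_on_def x0_def)
  qed
  have c2: "((\<lambda>z. G (fst z) (snd z) - G (fst z) \<xi>0) \<longlongrightarrow> 0) ?F"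
  proof (rule Lim_null_comparison)
    have "eventually (\<lambda>z. dist (snd z) \<xi>0 < 1) ?F" using lim(2) by (rule tendstoD) simp
    with ev\<Omega> show "eventually (\<lambda>z. norm (G (fst z) (snd z) - G (fst z) \<xi>0) \<le> c * ?R powr r * norm (snd z - \<xi>0)) ?F"
    proof eventually_elim
      case (elim z)
      then have "norm (snd z) \<le> ?R"
        using norm_triangle_sub[of "snd z" \<xi>0] by (simp add: dist_norm)
      then show ?case
        using powr_growth_increment[OF grad[OF elim(1)] \<Phi>[OF elim(1)] c r, of \<xi>0 ?R "snd z"] by simp
    qed
    have "((\<lambda>z. c * ?R powr r * norm (snd z - \<xi>0)) \<longlongrightarrow> c * ?R powr r * norm (\<xi>0 - \<xi>0)) ?F"
      by (intro tendsto_intros lim)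
    then show "((\<lambda>z. c * ?R powr r * norm (snd z - \<xi>0)) \<longlongrightarrow> 0) ?F" by simp
  qed
  show "((\<lambda>(x, \<xi>). G x \<xi>) \<longlongrightarrow> (\<lambda>(x, \<xi>). G x \<xi>) z0) ?F"
    using tendsto_add[OF c2 c1] by (simp add: case_prod_unfold x0_def \<xi>0_def)
qed

lemma measurable_caratheodory:
  fixes f :: "'a::euclidean_space \<Rightarrow> 'b::euclidean_space \<Rightarrow> 'c::euclidean_space"
  assumes \<Omega>: "open \<Omega>" and f: "continuous_on (\<Omega> \<times> UNIV) (\<lambda>(x, \<xi>). f x \<xi>)"
    and w: "w \<in> borel_measurable (lebesgue_on \<Omega>)"
  shows "(\<lambda>x. f x (w x)) \<in> borel_measurable (lebesgue_on \<Omega>)"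
proof -
  have id: "(\<lambda>x. x) \<in> borel_measurable (lebesgue_on \<Omega>)"
    by (rule continuous_UNIV_measurable_lebesgue_on) (rule continuous_on_id)
  have "(\<lambda>x. (x, w x)) \<in> lebesgue_on \<Omega> \<rightarrow>\<^sub>M restrict_space borel (\<Omega> \<times> UNIV)"
    using w id by (intro measurable_restrict_space2 borel_measurable_Pair) (auto simp: space_restrict_space)
  from measurable_compose[OF this borel_measurable_continuous_on_restrict[OF f]]
  show ?thesis by simp
qed

lemma Lp_integrable_powr:
  fixes f :: "'a::euclidean_space \<Rightarrow> 'b::euclidean_space"
  assumes \<Omega>: "open \<Omega>" "bounded \<Omega>" and f: "f \<in> Lp \<Omega> p" and r: "0 \<le> r" "r \<le> p"
  shows "integrable (lebesgue_on \<Omega>) (\<lambda>x. norm (f x) powr r)"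
proof -
  interpret finite_measure "lebesgue_on \<Omega>" by (rule finite_measure_lebesgue_on_bounded[OF \<Omega>])
  have [measurable]: "f \<in> borel_measurable (lebesgue_on \<Omega>)" and int: "integrable (lebesgue_on \<Omega>) (\<lambda>x. norm (f x) powr p)"
    using f by (auto simp: Lp_def)
  show ?thesis
  proof (rule Bochner_Integration.integrable_bound)
    show "integrable (lebesgue_on \<Omega>) (\<lambda>x. 1 + norm (f x) powr p)" using int by simp
    show "AE x in lebesgue_on \<Omega>. norm (norm (f x) powr r) \<le> norm (1 + norm (f x) powr p)"
    proof (rule AE_I2)
      fix x
      show "norm (norm (f x) powr r) \<le> norm (1 + norm (f x) powr p)"
      proof (cases "norm (f x) \<le> 1")
        case True
        then have "norm (f x) powr r \<le> 1 powr r" using r by (intro powr_mono2) auto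
        then show ?thesis by (simp add: add_increasing2)
      next
        case False
        then have "norm (f x) powr r \<le> norm (f x) powr p" using r by (intro powr_mono) auto
        then show ?thesis by simp
      qed
    qed
  qed measurable
qed

lemma Lp_add_const_integrable_powr:
  fixes f :: "'a::euclidean_space \<Rightarrow> 'b::euclidean_space"
  assumes \<Omega>: "open \<Omega>" "bounded \<Omega>" and f: "f \<in> Lp \<Omega> p" and r: "0 \<le> r" "r \<le> p" and c: "0 \<le> a" "0 \<le> B"
  shows "integrable (lebesgue_on \<Omega>) (\<lambda>x. (a * norm (f x) + B) powr r)"
proof -
  have [measurable]: "f \<in> borel_measurable (lebesgue_on \<Omega>)" and int: "integrable (lebesgue_on \<Omega>) (\<lambda>x. norm (f x) powr p)"
    using f by (auto simp: Lp_def)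
  have "(\<lambda>x. a * norm (f x)) \<in> Lp \<Omega> p"
    using int c by (auto simp: Lp_def abs_mult powr_mult)
  moreover have "(\<lambda>x. B) \<in> Lp \<Omega> p"
    by (rule bounded_in_Lp[OF \<Omega>, where B=B]) (use r c in auto)
  ultimately have "(\<lambda>x. a * norm (f x) + B) \<in> Lp \<Omega> p"
    using r by (intro Lp_add) auto
  from Lp_integrable_powr[OF \<Omega> this r] show ?thesis using c by simp
qed

section \<open>First variation and the measure of a minimizer\<close>

text \<open>The properties of the energy and of its minimizer from which the measure is built. The growth bound on
  \<open>\<Phi>\<close> is the case \<open>z = 0\<close> of the structural bound with a free real \<open>z\<close>.\<close>
locale p_energy_minimizer =
  fixes \<Omega> :: "'a::euclidean_space set"
    and p q c :: real
    and g lam u :: "'a \<Rightarrow> real"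
    and G :: "'a \<Rightarrow> 'a \<Rightarrow> real"
    and h :: "'a \<Rightarrow> real \<Rightarrow> real"
    and \<Phi> :: "'a \<Rightarrow> 'a \<Rightarrow> 'a"
  assumes open_dom: "open \<Omega>" and bounded_dom: "bounded \<Omega>"
    and p: "1 < p" and q: "0 \<le> q" "q < p - 1"
    and G_cont: "\<And>\<xi>. continuous_on \<Omega> (\<lambda>x. G x \<xi>)"
    and G_grad: "\<And>x \<xi>. x \<in> \<Omega> \<Longrightarrow> GDERIV (G x) \<xi> :> \<Phi> x \<xi>"
    and \<Phi>_cont: "continuous_on (\<Omega> \<times> UNIV) (\<lambda>(x, \<xi>). \<Phi> x \<xi>)"
    and c: "0 \<le> c" and \<Phi>_bound: "\<And>x \<xi>. x \<in> \<Omega> \<Longrightarrow> norm (\<Phi> x \<xi>) \<le> c * norm \<xi> powr (p - 1)"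
    and lam_cont: "continuous_on \<Omega> lam" and lam_nonneg: "\<And>x. x \<in> \<Omega> \<Longrightarrow> 0 \<le> lam x"
    and lam_bounded: "bounded (lam ` \<Omega>)"
    and h_cont: "\<And>x. x \<in> \<Omega> \<Longrightarrow> continuous_on UNIV (h x)"
    and h_deriv: "\<And>x s. x \<in> \<Omega> \<Longrightarrow> s \<noteq> 0 \<Longrightarrow>
          (h x has_real_derivative (q + 1) * lam x * max s 0 powr q) (at s)"
    and u_min: "is_minimizer \<Omega> (\<lambda>x s \<xi>. G x \<xi> + h x s) (K_class \<Omega> p g) u"
    and u_nonneg: "AE x in lebesgue_on \<Omega>. 0 \<le> u x"
begin

abbreviation N :: "'a measure" where "N \<equiv> lebesgue_on \<Omega>"

abbreviation Du :: "'a \<Rightarrow> 'a" where "Du \<equiv> weak_grad \<Omega> u"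

text \<open>The integrand of the Euler-Lagrange form of the energy at \<open>u\<close>.\<close>
definition el_density :: "('a \<Rightarrow> real) \<Rightarrow> 'a \<Rightarrow> real" where
  "el_density v x = \<Phi> x (Du x) \<bullet> grad v x
     + (q + 1) * lam x * u x powr q * indicator {x\<in>\<Omega>. u x > 0} x * v x"

text \<open>The slope of the kink of \<open>h x\<close> at \<open>0\<close>, on the set where \<open>u\<close> touches \<open>0\<close>; there is a kink only for \<open>q = 0\<close>.\<close>
definition contact_weight :: "'a \<Rightarrow> real" where
  "contact_weight x = (if q = 0 \<and> u x = 0 then lam x else 0)"

lemma space_N [simp]: "space N = \<Omega>"
  by (simp add: space_restrict_space)

lemma finite_N: "finite_measure N"
  by (rule finite_measure_lebesgue_on_bounded[OF open_dom bounded_dom])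

lemma u_K: "u \<in> K_class \<Omega> p g"
  using u_min by (simp add: is_minimizer_def)

lemma u_W1p: "u \<in> W1p \<Omega> p"
  using u_K by (auto simp: K_class_def)

lemma u_Lp: "u \<in> Lp \<Omega> p"
  using u_W1p by (auto simp: W1p_def)

lemma Du_Lp: "Du \<in> Lp \<Omega> p"
  by (rule W1p_weak_grad(2)[OF open_dom u_W1p])

lemma measurable_u [measurable]: "u \<in> borel_measurable N"
  using u_Lp by (simp add: Lp_def)

lemma measurable_Du [measurable]: "Du \<in> borel_measurable N"
  using Du_Lp by (simp add: Lp_def)

lemma measurable_lam [measurable]: "lam \<in> borel_measurable N"
  using continuous_imp_measurable_on_sets_lebesgue[OF lam_cont] open_dom by simp

lemma measurable_G:
  assumes "f \<in> borel_measurable N"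
  shows "(\<lambda>x. G x (f x)) \<in> borel_measurable N"
proof (rule measurable_caratheodory[OF open_dom _ assms])
  show "continuous_on (\<Omega> \<times> UNIV) (\<lambda>(x, \<xi>). G x \<xi>)"
    by (rule continuous_on_joint_of_growth[OF G_cont G_grad \<Phi>_bound c]) (use p in auto)
qed

lemma measurable_\<Phi> [measurable]: "(\<lambda>x. \<Phi> x (Du x)) \<in> borel_measurable N"
  by (rule measurable_caratheodory[OF open_dom \<Phi>_cont measurable_Du])

lemma lam_bound: obtains \<Lambda> where "0 \<le> \<Lambda>" "\<And>x. x \<in> \<Omega> \<Longrightarrow> lam x \<le> \<Lambda>"
proof -
  obtain B where "\<And>x. x \<in> \<Omega> \<Longrightarrow> \<bar>lam x\<bar> \<le> B" using lam_bounded by (auto simp: bounded_iff)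
  then show ?thesis by (intro that[of "max B 0"]) (auto simp: le_max_iff_disj abs_le_iff)
qed

lemma h_formula:
  assumes "x \<in> \<Omega>"
  shows "h x s = h x 0 + lam x * max s 0 powr (q + 1)"
  by (rule max_powr_antiderivative[OF q(1) h_cont[OF assms] h_deriv[OF assms]])

lemma measurable_contact_weight [measurable]: "contact_weight \<in> borel_measurable N"
  unfolding contact_weight_def[abs_def] by measurable

text \<open>The one-sided Euler-Lagrange inequality. The difference quotients \<open>D n\<close> of the energy density have
  non-negative integrals by minimality, and they are dominated: the gradient part by the growth of \<open>\<Phi>\<close>
  and \<open>Du\<close> in \<open>L\<^sup>p\<close>, the zero order part because \<open>q < p\<close> and \<open>u\<close> is in \<open>L\<^sup>p\<close>. The two integrals are kept apart
  because the first is linear in \<open>\<phi>\<close> while the second is only sublinear.\<close>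
lemma first_variation:
  assumes \<phi>: "\<phi> \<in> test_functions \<Omega>"
  shows "integrable N (el_density \<phi>)" and "0 \<le> (LINT x|N. el_density \<phi> x) + (LINT x|N. contact_weight x * max (\<phi> x) 0)"
proof -
  interpret finite_measure N by (rule finite_N)
  obtain B where B: "0 < B" "\<And>x. \<bar>\<phi> x\<bar> \<le> B" "\<And>x. norm (grad \<phi> x) \<le> B"
    using test_function_bounded[OF \<phi>] by metis
  obtain \<Lambda> where \<Lambda>: "0 \<le> \<Lambda>" "\<And>x. x \<in> \<Omega> \<Longrightarrow> lam x \<le> \<Lambda>" using lam_bound by metis
  note [measurable] = test_function_measurable[OF \<phi>, of \<Omega>]
  define t :: "nat \<Rightarrow> real" where "t n = 1 / (real n + 1)" for n
  have t: "0 < t n" "t n \<le> 1" for n by (auto simp: t_def)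
  have t0: "t \<longlonglongrightarrow> 0" unfolding t_def using LIMSEQ_inverse_real_of_nat
    by (simp add: inverse_eq_divide add.commute)
  define P where "P s = max s 0 powr (q + 1)" for s :: real
  define D where "D n x = (G x (Du x + t n *\<^sub>R grad \<phi> x) - G x (Du x)) / t n
      + lam x * ((P (u x + t n * \<phi> x) - P (u x)) / t n)" for n x
  \<comment> \<open>For \<open>t \<le> 1\<close> the segment from \<open>Du x\<close> to \<open>Du x + t *\<^sub>R grad \<phi> x\<close> lies in the ball of radius \<open>norm (Du x) + B\<close>,
    and \<open>\<bar>u x\<bar> + \<bar>u x + t * \<phi> x\<bar>\<close> is at most \<open>2 * \<bar>u x\<bar> + B\<close>.\<close>
  define dom where "dom x = c * (1 * norm (Du x) + B) powr (p - 1) * B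
      + \<Lambda> * ((q + 1) * (2 * norm (u x) + B) powr q * B)" for x
  have int_dom: "integrable N dom"
    unfolding dom_def using p q B c \<Lambda>
    by (intro Bochner_Integration.integrable_add integrable_mult_left integrable_mult_right
          Lp_add_const_integrable_powr[OF open_dom bounded_dom Du_Lp]
          Lp_add_const_integrable_powr[OF open_dom bounded_dom u_Lp]) auto
  have D_measurable: "D n \<in> borel_measurable N" for n
  proof -
    have [measurable]: "(\<lambda>x. G x (Du x + t n *\<^sub>R grad \<phi> x)) \<in> borel_measurable N" "(\<lambda>x. G x (Du x)) \<in> borel_measurable N"
      by (intro measurable_G; measurable)+
    show ?thesis unfolding D_def[abs_def] P_def by measurable
  qed
  have D_bound: "norm (D n x) \<le> dom x" if x: "x \<in> \<Omega>" for n x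
  proof -
    have tg: "norm (t n *\<^sub>R grad \<phi> x) \<le> B"
      using mult_mono[OF t(2)[of n] B(3)[of x]] t[of n] by simp
    have "\<bar>G x (Du x + t n *\<^sub>R grad \<phi> x) - G x (Du x)\<bar>
        \<le> c * (1 * norm (Du x) + B) powr (p - 1) * norm (Du x + t n *\<^sub>R grad \<phi> x - Du x)"
      using p B(1) tg norm_triangle_ineq[of "Du x" "t n *\<^sub>R grad \<phi> x"]
      by (intro powr_growth_increment[OF G_grad[OF x] \<Phi>_bound[OF x] c]) auto
    also have "\<dots> \<le> c * (1 * norm (Du x) + B) powr (p - 1) * (t n * B)"
      using c t[of n] B(3)[of x] by (intro mult_left_mono) auto
    finally have 1: "\<bar>(G x (Du x + t n *\<^sub>R grad \<phi> x) - G x (Du x)) / t n\<bar> \<le> c * (1 * norm (Du x) + B) powr (p - 1) * B"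
      using t(1)[of n] by (simp add: field_simps)
    have t\<phi>: "\<bar>t n * \<phi> x\<bar> \<le> t n * B" "t n * B \<le> B"
      using B t[of n] by (simp_all add: abs_mult mult_left_le_one_le)
    then have u\<phi>: "\<bar>u x\<bar> + \<bar>u x + t n * \<phi> x\<bar> \<le> 2 * norm (u x) + B" by simp
    have "\<bar>P (u x + t n * \<phi> x) - P (u x)\<bar> \<le> (q + 1) * (\<bar>u x\<bar> + \<bar>u x + t n * \<phi> x\<bar>) powr q * \<bar>u x + t n * \<phi> x - u x\<bar>"
      unfolding P_def by (rule max_powr_diff_le[OF q(1)])
    also have "\<dots> \<le> (q + 1) * (2 * norm (u x) + B) powr q * (t n * B)"
      using q t\<phi>(1) u\<phi> by (intro mult_mono mult_left_mono powr_mono2) auto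
    finally have "\<bar>(P (u x + t n * \<phi> x) - P (u x)) / t n\<bar> \<le> (q + 1) * (2 * norm (u x) + B) powr q * B"
      using t(1)[of n] by (simp add: field_simps)
    then have 2: "\<bar>lam x * ((P (u x + t n * \<phi> x) - P (u x)) / t n)\<bar> \<le> \<Lambda> * ((q + 1) * (2 * norm (u x) + B) powr q * B)"
      unfolding abs_mult using lam_nonneg[OF x] \<Lambda>(2)[OF x] by (intro mult_mono) auto
    show ?thesis
      using order_trans[OF abs_triangle_ineq add_mono[OF 1 2]] by (simp add: D_def dom_def)
  qed
  have D_int: "integrable N (D n)" for n
  proof (rule Bochner_Integration.integrable_bound[OF int_dom D_measurable], rule AE_I2)
    show "norm (D n x) \<le> norm (dom x)" if "x \<in> space N" for x
      using D_bound[of x n] that by simp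
  qed
  \<comment> \<open>The energy density of the competitor is \<open>?Fu + t n * D n\<close> almost everywhere; in particular its energy
    is finite, so minimality applies.\<close>
  have D_nonneg: "0 \<le> (LINT x|N. D n x)" for n
  proof -
    let ?v = "\<lambda>x. u x + t n * \<phi> x"
    let ?Fu = "\<lambda>x. G x (Du x) + h x (u x)" and ?Fv = "\<lambda>x. G x (weak_grad \<Omega> ?v x) + h x (?v x)"
    have F0: "integrable N ?Fu" using u_min by (simp add: is_minimizer_def)
    have "AE x in N. weak_grad \<Omega> ?v x = Du x + t n *\<^sub>R grad \<phi> x"
      using p by (intro W1p_add_test(2)[OF open_dom bounded_dom _ u_W1p \<phi>]) simp
    moreover have "AE x in N. x \<in> \<Omega>" by (rule AE_I2) simp
    ultimately have eq: "AE x in N. ?Fu x + t n * D n x = ?Fv x"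
    proof eventually_elim
      case (elim x)
      then show ?case
        using t(1)[of n] h_formula[OF elim(2), of "u x"] h_formula[OF elim(2), of "?v x"]
        by (simp add: D_def P_def field_simps)
    qed
    have int: "integrable N (\<lambda>x. ?Fu x + t n * D n x)"
      by (intro Bochner_Integration.integrable_add F0 integrable_mult_right D_int)
    then have F_meas: "?Fv \<in> borel_measurable N"
      by (intro borel_measurable_lebesgue_on_AE[OF open_dom borel_measurable_integrable[OF int] eq])
    have F: "integrable N ?Fv"
      using int integrable_cong_AE[OF borel_measurable_integrable[OF int] F_meas eq] by simp
    have "?v \<in> K_class \<Omega> p g"
      using p by (intro K_class_add_test[OF open_dom bounded_dom _ u_K \<phi>]) simp
    then have "(LINT x|N. ?Fu x) \<le> (LINT x|N. ?Fv x)"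
      using u_min F by (auto simp: is_minimizer_def)
    also have "(LINT x|N. ?Fv x) = (LINT x|N. ?Fu x + t n * D n x)"
      by (rule integral_cong_AE[OF F_meas borel_measurable_integrable[OF int]])
         (use eq in \<open>auto elim: eventually_mono\<close>)
    also have "\<dots> = (LINT x|N. ?Fu x) + t n * (LINT x|N. D n x)"
      by (subst Bochner_Integration.integral_add[OF F0]) (simp_all add: D_int)
    finally show ?thesis using t(1)[of n] by (simp add: zero_le_mult_iff)
  qed
  have [measurable]: "(indicator {x \<in> \<Omega>. 0 < u x} :: 'a \<Rightarrow> real) \<in> borel_measurable N"
  proof (rule borel_measurable_indicator)
    have "{x \<in> space N. 0 < u x} \<in> sets N" by measurable
    then show "{x \<in> \<Omega>. 0 < u x} \<in> sets N" by simp
  qed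
  have [measurable]: "el_density \<phi> \<in> borel_measurable N" unfolding el_density_def[abs_def] by measurable
  have lim: "AE x in N. (\<lambda>n. D n x) \<longlonglongrightarrow> el_density \<phi> x + contact_weight x * max (\<phi> x) 0"
    using u_nonneg AE_space
  proof eventually_elim
    case (elim x)
    then have x: "x \<in> \<Omega>" and ux: "0 \<le> u x" by auto
    have "((\<lambda>s. Du x + s *\<^sub>R grad \<phi> x) has_derivative (\<lambda>s. s *\<^sub>R grad \<phi> x)) (at 0)"
      by (auto intro!: derivative_eq_intros)
    moreover have "(G x has_derivative (\<lambda>k. k \<bullet> \<Phi> x (Du x))) (at (Du x + 0 *\<^sub>R grad \<phi> x))"
      using G_grad[OF x, of "Du x"] by (simp add: gderiv_def)
    ultimately have "((\<lambda>s. G x (Du x + s *\<^sub>R grad \<phi> x)) has_derivative (\<lambda>s. (s *\<^sub>R grad \<phi> x) \<bullet> \<Phi> x (Du x))) (at 0)"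
      by (rule has_derivative_compose)
    then have "((\<lambda>s. G x (Du x + s *\<^sub>R grad \<phi> x)) has_real_derivative \<Phi> x (Du x) \<bullet> grad \<phi> x) (at 0)"
      by (simp add: has_field_derivative_def inner_commute mult_commute_abs)
    then have "((\<lambda>s. (G x (Du x + s *\<^sub>R grad \<phi> x) - G x (Du x)) / s) \<longlongrightarrow> \<Phi> x (Du x) \<bullet> grad \<phi> x) (at 0)"
      by (simp add: has_field_derivative_iff)
    moreover have "filterlim t (at 0) sequentially"
      using t0 t(1) by (auto simp: filterlim_at less_imp_neq[symmetric] intro!: always_eventually)
    ultimately have 1: "(\<lambda>n. (G x (Du x + t n *\<^sub>R grad \<phi> x) - G x (Du x)) / t n) \<longlonglongrightarrow> \<Phi> x (Du x) \<bullet> grad \<phi> x"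
      by (rule filterlim_compose)
    have 2: "(\<lambda>n. (P (u x + t n * \<phi> x) - P (u x)) / t n) \<longlonglongrightarrow>
        (q + 1) * u x powr q * \<phi> x + (if q = 0 \<and> u x = 0 then max (\<phi> x) 0 else 0)"
      unfolding P_def by (rule max_powr_directional_derivative[OF q(1) ux t(1) t0])
    have "(\<lambda>n. D n x) \<longlonglongrightarrow> \<Phi> x (Du x) \<bullet> grad \<phi> x + lam x *
        ((q + 1) * u x powr q * \<phi> x + (if q = 0 \<and> u x = 0 then max (\<phi> x) 0 else 0))"
      unfolding D_def by (intro tendsto_add 1 tendsto_mult 2 tendsto_const)
    also have "\<Phi> x (Du x) \<bullet> grad \<phi> x + lam x *
        ((q + 1) * u x powr q * \<phi> x + (if q = 0 \<and> u x = 0 then max (\<phi> x) 0 else 0))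
        = el_density \<phi> x + contact_weight x * max (\<phi> x) 0"
      using x ux by (auto simp: el_density_def contact_weight_def indicator_def algebra_simps)
    finally show ?case .
  qed
  have lim_int: "integrable N (\<lambda>x. el_density \<phi> x + contact_weight x * max (\<phi> x) 0)"
    and "(\<lambda>n. LINT x|N. D n x) \<longlonglongrightarrow> (LINT x|N. el_density \<phi> x + contact_weight x * max (\<phi> x) 0)"
    using D_bound D_measurable
    by (auto intro!: integrable_dominated_convergence[OF _ _ int_dom lim]
        integral_dominated_convergence[OF _ _ int_dom lim])
  then have nonneg: "0 \<le> (LINT x|N. el_density \<phi> x + contact_weight x * max (\<phi> x) 0)"
    using D_nonneg by (intro LIMSEQ_le_const) auto
  have contact_weight_int: "integrable N (\<lambda>x. contact_weight x * max (\<phi> x) 0)"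
  proof (rule integrable_const_bound[where B="\<Lambda> * B"])
    show "AE x in N. norm (contact_weight x * max (\<phi> x) 0) \<le> \<Lambda> * B"
    proof (rule AE_I2)
      fix x assume "x \<in> space N"
      then have x: "x \<in> \<Omega>" by simp
      have "\<bar>contact_weight x\<bar> \<le> \<Lambda>" "\<bar>max (\<phi> x) 0\<bar> \<le> B"
        using lam_nonneg[OF x] \<Lambda>(1) \<Lambda>(2)[OF x] B(1) B(2)[of x] by (auto simp: contact_weight_def)
      then show "norm (contact_weight x * max (\<phi> x) 0) \<le> \<Lambda> * B"
        unfolding real_norm_def abs_mult using \<Lambda>(1) by (intro mult_mono) auto
    qed
  qed measurable
  show el_int: "integrable N (el_density \<phi>)"
    using Bochner_Integration.integrable_diff[OF lim_int contact_weight_int] by simp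
  show "0 \<le> (LINT x|N. el_density \<phi> x) + (LINT x|N. contact_weight x * max (\<phi> x) 0)"
    using nonneg el_int contact_weight_int by simp
qed

lemma contact_weight_nonneg: "x \<in> \<Omega> \<Longrightarrow> 0 \<le> contact_weight x"
  using lam_nonneg by (auto simp: contact_weight_def)

lemma test_combination:
  assumes "f \<in> test_functions \<Omega>" "k \<in> test_functions \<Omega>"
  shows "(\<lambda>x. f x + a * k x) \<in> test_functions \<Omega>"
    and "el_density (\<lambda>x. f x + a * k x) x = el_density f x + a * el_density k x"
proof -
  note ak = test_functions_cmult[OF assms(2), of a]
  show "(\<lambda>x. f x + a * k x) \<in> test_functions \<Omega>" by (rule test_functions_add[OF assms(1) ak])
  show "el_density (\<lambda>x. f x + a * k x) x = el_density f x + a * el_density k x"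
    by (simp add: el_density_def grad_add[OF assms(1) ak] grad_cmult[OF assms(2)] inner_add_right algebra_simps)
qed

lemma zero_test_function: "(\<lambda>x. 0) \<in> test_functions S"
  by (simp add: test_functions_def Ck_on_const)

text \<open>The measure with density \<open>contact_weight\<close>, moved from the Lebesgue to the Borel sets of \<open>\<Omega>\<close>, where Radon measures
  live. The push-forward is needed because the weight itself may fail to be Borel measurable.\<close>
definition contact_measure :: "'a measure" where
  "contact_measure = distr (density N (\<lambda>x. ennreal (contact_weight x))) (restrict_space borel \<Omega>) (\<lambda>x. x)"

lemma id_measurable: "(\<lambda>x. x) \<in> measurable N (restrict_space borel \<Omega>)"
proof (rule measurable_restrict_space2)
  show "(\<lambda>x. x) \<in> borel_measurable N"
    by (rule continuous_UNIV_measurable_lebesgue_on) (rule continuous_on_id)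
qed simp

lemma sets_contact_measure: "sets contact_measure = sets (restrict_space borel \<Omega>)"
  by (simp add: contact_measure_def)

lemma emeasure_contact_measure:
  assumes "A \<in> sets (restrict_space borel \<Omega>)"
  shows "emeasure contact_measure A = (\<integral>\<^sup>+x. ennreal (contact_weight x) * indicator A x \<partial>N)"
proof -
  have A: "A \<subseteq> \<Omega>" using sets.sets_into_space[OF assms] by (simp add: space_restrict_space)
  have AN: "A \<in> sets N"
    using measurable_sets[OF id_measurable assms] A by (simp add: Int_absorb2)
  have "emeasure contact_measure A = emeasure (density N (\<lambda>x. ennreal (contact_weight x))) A"
    unfolding contact_measure_def using assms A id_measurable
    by (subst emeasure_distr) (auto simp: measurable_density_eq2 Int_absorb2)
  also have "\<dots> = (\<integral>\<^sup>+x. ennreal (contact_weight x) * indicator A x \<partial>N)"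
    using AN by (intro emeasure_density) auto
  finally show ?thesis .
qed

lemma finite_contact_measure: "finite_measure contact_measure"
proof
  interpret finite_measure N by (rule finite_N)
  obtain \<Lambda> where \<Lambda>: "0 \<le> \<Lambda>" "\<And>x. x \<in> \<Omega> \<Longrightarrow> lam x \<le> \<Lambda>" using lam_bound by metis
  have spM: "space contact_measure = \<Omega>" by (simp add: contact_measure_def space_restrict_space)
  have "emeasure contact_measure (space contact_measure) = (\<integral>\<^sup>+x. ennreal (contact_weight x) * indicator \<Omega> x \<partial>N)"
    using sets.top[of "restrict_space borel \<Omega> :: 'a measure"] unfolding spM
    by (intro emeasure_contact_measure) (simp add: space_restrict_space)
  also have "\<dots> \<le> (\<integral>\<^sup>+x. ennreal \<Lambda> \<partial>N)"
    using \<Lambda> by (intro nn_integral_mono) (auto simp: contact_weight_def indicator_def intro!: ennreal_leI)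
  also have "\<dots> < \<infinity>"
    using emeasure_finite[of \<Omega>] by (simp add: ennreal_mult_eq_top_iff less_top[symmetric])
  finally show "emeasure contact_measure (space contact_measure) \<noteq> \<infinity>" by simp
qed

lemma test_function_contact_measure:
  assumes \<phi>: "\<phi> \<in> test_functions \<Omega>"
  shows "integrable contact_measure \<phi>" "(LINT x|contact_measure. max (\<phi> x) 0) = (LINT x|N. contact_weight x * max (\<phi> x) 0)"
proof -
  interpret finite_measure contact_measure by (rule finite_contact_measure)
  obtain B where B: "\<And>x. \<bar>\<phi> x\<bar> \<le> B"
    using test_function_bounded[OF \<phi>] by metis
  have \<phi>B: "\<phi> \<in> borel_measurable (restrict_space borel \<Omega>)"
    using test_function_continuous(1)[OF \<phi>]
    by (intro measurable_restrict_space1 borel_measurable_continuous_onI)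
  then have "\<phi> \<in> borel_measurable contact_measure" using measurable_cong_sets[OF sets_contact_measure refl] by blast
  then show "integrable contact_measure \<phi>" by (intro integrable_const_bound[where B=B]) (use B in auto)
  have id: "(\<lambda>x. x) \<in> measurable (density N (\<lambda>x. ennreal (contact_weight x))) (restrict_space borel \<Omega>)"
    using id_measurable by simp
  have "(LINT x|contact_measure. max (\<phi> x) 0) = (LINT x|density N (\<lambda>x. ennreal (contact_weight x)). max (\<phi> x) 0)"
    unfolding contact_measure_def using \<phi>B by (intro integral_distr[OF id]) measurable
  also have "\<dots> = (LINT x|N. contact_weight x *\<^sub>R max (\<phi> x) 0)"
    using test_function_measurable(1)[OF \<phi>, of \<Omega>] contact_weight_nonneg by (intro integral_density) auto
  finally show "(LINT x|contact_measure. max (\<phi> x) 0) = (LINT x|N. contact_weight x * max (\<phi> x) 0)" by simp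
qed

theorem radon_measure_exists:
  "\<exists>\<mu>. radon_measure_on \<Omega> \<mu> \<and>
     (\<forall>v\<in>test_functions \<Omega>. integrable N (el_density v) \<and> (LINT x|\<mu>. v x) = - (LINT x|N. el_density v x)) \<and>
     measure_support \<mu> \<subseteq> frontier {x\<in>\<Omega>. u x > 0} \<inter> \<Omega>"
proof -
  let ?T = "test_functions \<Omega>" and ?L = "\<lambda>v. - (LINT x|N. el_density v x)"
  have L_le: "?L v \<le> (LINT x|contact_measure. max (v x) 0)" if "v \<in> ?T" for v
    using first_variation(2)[OF that] test_function_contact_measure(2)[OF that] by simp
  have L_lin: "?L (\<lambda>x. f x + a * k x) = ?L f + a * ?L k" if "f \<in> ?T" "k \<in> ?T" for f k a
  proof -
    have "(LINT x|N. el_density (\<lambda>x. f x + a * k x) x) = (LINT x|N. el_density f x + a * el_density k x)"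
      by (simp only: test_combination(2)[OF that])
    also have "\<dots> = (LINT x|N. el_density f x) + a * (LINT x|N. el_density k x)"
      using first_variation(1)[OF that(1)] first_variation(1)[OF that(2)] by simp
    finally show ?thesis by simp
  qed
  have T_ne: "?T \<noteq> {}" using zero_test_function by blast
  obtain \<mu> where sets\<mu>: "sets \<mu> = sets contact_measure" and le: "\<And>A. A \<in> sets contact_measure \<Longrightarrow> emeasure \<mu> A \<le> emeasure contact_measure A"
    and int: "\<And>f :: 'a \<Rightarrow> real. integrable contact_measure f \<Longrightarrow> integrable \<mu> f"
    and rep: "\<And>f. f \<in> ?T \<Longrightarrow> (LINT x|\<mu>. f x) = ?L f"
    by (rule dominated_functional_measure[OF finite_contact_measure test_function_contact_measure(1) T_ne test_combination(1) L_lin L_le])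
       (assumption | blast)+
  have sets': "sets \<mu> = sets (restrict_space borel \<Omega>)" using sets\<mu> sets_contact_measure by simp
  have sp: "space \<mu> = \<Omega>" using sets_eq_imp_space_eq[OF sets'] by (simp add: space_restrict_space)
  have opens: "U \<in> sets \<mu>" if "open U" "U \<subseteq> \<Omega>" for U
    using that open_dom by (simp add: sets' sets_restrict_space_iff)
  have "finite_measure \<mu>"
  proof
    have "emeasure \<mu> \<Omega> \<le> emeasure contact_measure \<Omega>" using opens[OF open_dom] sets\<mu> by (intro le) simp
    also have "\<dots> < \<infinity>" using finite_measure.emeasure_finite[OF finite_contact_measure] by (simp add: less_top[symmetric])
    finally show "emeasure \<mu> (space \<mu>) \<noteq> \<infinity>" by (simp add: sp)
  qed
  then have radon: "radon_measure_on \<Omega> \<mu>"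
    by (rule finite_measure_imp_radon_measure_on[OF open_dom sets'])
  let ?S = "{x\<in>\<Omega>. u x > 0}"
  have "x \<in> frontier ?S" if supp: "x \<in> measure_support \<mu>" for x
  proof (rule ccontr)
    assume "x \<notin> frontier ?S"
    have pos: "0 < emeasure \<mu> U" if "open U" "x \<in> U" "U \<subseteq> \<Omega>" for U
      using supp that by (auto simp: measure_support_def sp Int_absorb2)
    have x: "x \<in> \<Omega>" using supp by (simp add: measure_support_def sp)
    consider "x \<in> interior ?S" | "x \<in> \<Omega> - closure ?S"
      using \<open>x \<notin> frontier ?S\<close> x by (auto simp: frontier_def)
    then show False
    proof cases
      case 1
      let ?U = "interior ?S"
      have US: "?U \<subseteq> ?S" by (rule interior_subset)
      then have U: "?U \<subseteq> \<Omega>" by blast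
      have "emeasure \<mu> ?U \<le> emeasure contact_measure ?U" using opens[OF open_interior U] sets\<mu> by (intro le) simp
      also have "\<dots> = (\<integral>\<^sup>+x. ennreal (contact_weight x) * indicator ?U x \<partial>N)"
        using opens[OF open_interior U] sets' by (intro emeasure_contact_measure) simp
      also have "\<dots> = (\<integral>\<^sup>+x. 0 \<partial>N)"
        using US by (intro nn_integral_cong) (auto simp: contact_weight_def indicator_def)
      finally show False using pos[OF open_interior 1 U] by simp
    next
      case 2
      let ?U = "\<Omega> - closure ?S"
      have oU: "open ?U" using open_dom by (intro open_Diff) auto
      have US: "u y \<le> 0" if "y \<in> ?U" for y using that closure_subset[of ?S] by force
      obtain a b where ab: "cbox a b \<subseteq> ?U" "x \<in> box a b" using open_contains_cbox[OF oU 2] by metis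
      let ?v = "box_bump a b 1"
      have vU: "?v \<in> test_functions ?U" by (rule box_bump_test_function[OF ab(1)])
      then have v: "?v \<in> ?T" by (rule test_functions_mono[rotated]) auto
      have "AE y in lebesgue_on ?U. u y = 0"
      proof -
        have "AE y in lebesgue. y \<in> \<Omega> \<longrightarrow> 0 \<le> u y"
          using u_nonneg open_dom by (simp add: AE_restrict_space_iff)
        then have "AE y in lebesgue. y \<in> ?U \<longrightarrow> u y = 0"
          by eventually_elim (use US in \<open>force intro: antisym\<close>)
        then show ?thesis using oU by (simp add: AE_restrict_space_iff)
      qed
      then have "AE y in lebesgue_on ?U. Du y = 0"
        by (intro weak_gradient_zero[OF oU open_dom _ W1p_weak_grad(1)[OF open_dom u_W1p]]) auto
      then have "AE y in lebesgue. y \<in> ?U \<longrightarrow> Du y = 0"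
        using oU by (simp add: AE_restrict_space_iff)
      then have "AE y in lebesgue. y \<in> \<Omega> \<longrightarrow> el_density ?v y = 0"
      proof eventually_elim
        case (elim y)
        show ?case
        proof
          assume y: "y \<in> \<Omega>"
          show "el_density ?v y = 0"
          proof (cases "y \<in> ?U")
            case True
            have "\<Phi> y (Du y) = 0" using elim True \<Phi>_bound[OF y, of 0] by simp
            then show ?thesis using US[OF True] by (simp add: el_density_def indicator_def)
          next
            case False
            then show ?thesis using test_function_outside_domain[OF vU False] by (simp add: el_density_def)
          qed
        qed
      qed
      then have "AE y in N. el_density ?v y = 0" using open_dom by (simp add: AE_restrict_space_iff)
      then have "(LINT y|\<mu>. ?v y) = 0" using rep[OF v] by (simp add: integral_eq_zero_AE)
      then have AE0: "AE y in \<mu>. ?v y = 0"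
        using integral_nonneg_eq_0_iff_AE[OF int[OF test_function_contact_measure(1)[OF v]]
            AE_I2[OF box_bump_bounds(1)]] by blast
      have bU: "box a b \<subseteq> \<Omega>" using ab box_subset_cbox[of a b] by blast
      have "AE y in \<mu>. y \<notin> box a b"
        using AE0 by eventually_elim (use box_bump_pos[of _ a b 1] in force)
      then have "emeasure \<mu> (box a b) = 0"
        using AE_iff_measurable[OF opens[OF open_box bU], of "\<lambda>y. y \<notin> box a b"] bU by (auto simp: sp)
      then show False using pos[OF open_box ab(2) bU] by simp
    qed
  qed
  then have "measure_support \<mu> \<subseteq> frontier ?S \<inter> \<Omega>" by (auto simp: measure_support_def sp)
  with radon rep first_variation(1) show ?thesis by blast
qed

end

theorem lemma7p1:
  fixes \<Omega> :: "'a::euclidean_space set"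
    and p q \<zeta> c1 c2 c3 c4 \<kappa>1 :: real
    and g lam u :: "'a \<Rightarrow> real"
    and G :: "'a \<Rightarrow> 'a \<Rightarrow> real"
    and h :: "'a \<Rightarrow> real \<Rightarrow> real"
    and \<Phi> :: "'a \<Rightarrow> 'a \<Rightarrow> 'a"
  assumes dom: "regular_bounded_domain \<Omega>"
    and p: "1 < p" and q: "0 \<le> q" "q < p - 1"
    and g: "continuous_on (frontier \<Omega>) g" "\<And>x. x \<in> frontier \<Omega> \<Longrightarrow> 0 \<le> g x"
    and G_cont: "\<And>\<xi>. continuous_on \<Omega> (\<lambda>x. G x \<xi>)"
    and zeta: "0 < \<zeta>"
    and G_growth: "\<And>x \<xi>. x \<in> \<Omega> \<Longrightarrow>
          \<zeta> * norm \<xi> powr p \<le> G x \<xi> \<and> G x \<xi> \<le> inverse \<zeta> * norm \<xi> powr p"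
    and G_convex: "\<And>x. x \<in> \<Omega> \<Longrightarrow> strictly_convex_on UNIV (G x)"
    and G_grad: "\<And>x \<xi>. x \<in> \<Omega> \<Longrightarrow> GDERIV (G x) \<xi> :> \<Phi> x \<xi>"
    and lam: "continuous_on (closure \<Omega>) lam" "\<And>x. x \<in> closure \<Omega> \<Longrightarrow> 0 \<le> lam x"
             "bounded (lam ` closure \<Omega>)"
    and h_cont: "\<And>x. x \<in> \<Omega> \<Longrightarrow> continuous_on UNIV (h x)"
    and h_deriv: "\<And>x s. x \<in> \<Omega> \<Longrightarrow> s \<noteq> 0 \<or> 0 < q \<Longrightarrow>
          (h x has_real_derivative (q + 1) * lam x * max s 0 powr q) (at s)"
    and pos: "0 < c1" "0 < c2" "0 < c3" "0 < c4" "0 < \<kappa>1"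
    and H1: "continuous_on (\<Omega> \<times> UNIV) (\<lambda>(x, \<xi>). \<Phi> x \<xi>)"
    and H2: "\<And>x \<xi>1 \<xi>2. x \<in> \<Omega> \<Longrightarrow> 0 \<le> (\<Phi> x \<xi>1 - \<Phi> x \<xi>2) \<bullet> (\<xi>1 - \<xi>2)"
    and H3: "\<And>x \<xi> (z::real). x \<in> \<Omega> \<Longrightarrow>
          \<Phi> x \<xi> \<bullet> \<xi> \<ge> c1 * norm \<xi> powr p - c2 * \<bar>z\<bar> powr p"
    and H4: "\<And>x \<xi> (z::real). x \<in> \<Omega> \<Longrightarrow>
          norm (\<Phi> x \<xi>) \<le> c3 * norm \<xi> powr (p - 1) + c4 * \<bar>z\<bar> powr (p - 1)"
    and A1: "Ck_on 1 (\<lambda>(x, \<xi>). \<Phi> x \<xi>) (\<Omega> \<times> (UNIV - {0}))"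
    and A2: "2 \<le> p \<Longrightarrow> AE x in lebesgue_on \<Omega>. \<forall>\<xi>. \<xi> \<noteq> 0 \<longrightarrow>
          (\<Sum>i\<in>Basis. \<Sum>j\<in>Basis. \<bar>frechet_derivative (\<lambda>\<eta>. \<Phi> x \<eta>) (at \<xi>) j \<bullet> i\<bar>)
            \<le> \<kappa>1 * norm \<xi> powr (p - 2) \<and>
          (\<Sum>i\<in>Basis. \<Sum>j\<in>Basis. \<bar>frechet_derivative (\<lambda>y. \<Phi> y \<xi>) (at x) j \<bullet> i\<bar>)
            \<le> \<kappa>1 * norm \<xi> powr (p - 1)"
    and u_min: "is_minimizer \<Omega> (\<lambda>x s \<xi>. G x \<xi> + h x s) (K_class \<Omega> p g) u"
    and u_nonneg: "AE x in lebesgue_on \<Omega>. 0 \<le> u x"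
  shows "\<exists>\<mu>. radon_measure_on \<Omega> \<mu> \<and>
     (\<forall>v\<in>test_functions \<Omega>.
        integrable (lebesgue_on \<Omega>)
          (\<lambda>x. \<Phi> x (weak_grad \<Omega> u x) \<bullet> grad v x
                + (q + 1) * lam x * u x powr q * indicator {x\<in>\<Omega>. u x > 0} x * v x) \<and>
        (LINT x|\<mu>. v x) =
          - (LINT x|lebesgue_on \<Omega>. \<Phi> x (weak_grad \<Omega> u x) \<bullet> grad v x
                + (q + 1) * lam x * u x powr q * indicator {x\<in>\<Omega>. u x > 0} x * v x)) \<and>
     measure_support \<mu> \<subseteq> frontier {x\<in>\<Omega>. u x > 0} \<inter> \<Omega>"
proof -
  interpret p_energy_minimizer \<Omega> p q c3 g lam u G h \<Phi>
  proof
    show "norm (\<Phi> x \<xi>) \<le> c3 * norm \<xi> powr (p - 1)" if "x \<in> \<Omega>" for x \<xi>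
      using H4[OF that, of \<xi> 0] by simp
    show "continuous_on \<Omega> lam" using lam(1) closure_subset by (rule continuous_on_subset)
    show "bounded (lam ` \<Omega>)" using lam(3) image_mono[OF closure_subset] by (rule bounded_subset)
    show "0 \<le> lam x" if "x \<in> \<Omega>" for x using lam(2) closure_subset that by blast
  qed (use dom p q G_cont G_grad H1 pos h_cont h_deriv u_min u_nonneg in \<open>auto simp: regular_bounded_domain_def\<close>)
  show ?thesis using radon_measure_exists unfolding el_density_def[abs_def] .
qed

end
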